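(* Let $V\in\mathrm{U}(d,\mathbb{C})$ be a unitary matrix that is not real-valued, and let $\mathcal{R}_V\in\mathrm{Sp}(2d,\mathbb{R})$ be the associated symplectic matrix. Let $\Omega=\Omega(V)\in\mathrm{GL}(2d,\mathbb{R})$ be a matrix which, together with some index $1\le k\le d$ and some $\mathcal{B}\in\mathrm{Sp}(2d,\mathbb{R})$, gives the factorization $$|u|\otimes|\widehat{\mathcal{R}_V}u|=\widehat{\mathcal{D}_\Omega}\big(|\widehat{\mathcal{B}}u|\otimes|\mathcal{F}_k\widehat{\mathcal{B}}u|\big)\quad\text{for all }u\in L^2(\mathbb{R}^d).$$ If $f\in L^2(\mathbb{R}^d)$ satisfies $$\int_{\mathbb{R}^{2d}}|(f\otimes\widehat{\mathcal{R}_V}f)(\lambda)|\exp\left(\pi\left|\Omega^{-1}\lambda\cdot\begin{pmatrix} 0 & I_d \\ I_d & 0 \end{pmatrix}\Omega^{-1}\lambda\right|\right)d\lambda<\infty,$$ then $f\equiv0$.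
   Context: $f\equiv 0$ means zero a.e.; $(f\otimes g)(x,y)=f(x)g(y)$ for $x,y\in\mathbb{R}^d$. $\mathrm{Sp}(2d,\mathbb{R})=\{M\in\mathbb{R}^{2d\times 2d}: M^t\mathcal{J}M=\mathcal{J}\}$, $\mathcal{J}=\begin{pmatrix} 0 & I \\ -I & 0 \end{pmatrix}$. For $(x,\omega)\in\mathbb{R}^d\times\mathbb{R}^d$, $\rho(x,\omega)f(t)=e^{-\pi i x\cdot\omega}e^{2\pi i\omega\cdot t}f(t-x)$. For $M\in\mathrm{Sp}(2d,\mathbb{R})$, $\widehat{M}$ denotes an associated metaplectic operator: a unitary operator on $L^2(\mathbb{R}^d)$ with $\rho(M\lambda)=\widehat M\rho(\lambda)\widehat M^{-1}$ for all $\lambda\in\mathbb{R}^{2d}$; it is unique up to a factor of modulus 1 (irrelevant here, since only absolute values occur). For a unitary matrix $V=A+iB$ with real part $A$ and imaginary part $B$, $\mathcal{R}_V=\begin{pmatrix} A & B \\ -B & A \end{pmatrix}$. For $L\in\mathrm{GL}(n,\mathbb{R})$, $\widehat{\mathcal{D}_L}F(x)=|\det L|^{-1/2}F(L^{-1}x)$ on functions on $\mathbb{R}^n$. For $1\le k\le d$, the partial Fourier transform is $\mathcal{F}_kf(\omega_1,\omega_2)=\int_{\mathbb{R}^k}f(x_1,\omega_2)e^{-2\pi i\omega_1\cdot x_1}\,dx_1$, $(\omega_1,\omega_2)\in\mathbb{R}^k\times\mathbb{R}^{d-k}$, extended to a unitary operator on $L^2(\mathbb{R}^d)$ ($\mathcal{F}_d=\mathcal{F}$).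 Data $k,\mathcal{B},\Omega$ giving the factorization in the claim exist whenever $V$ is not real-valued. *)

theory Defs
  imports "HOL-Analysis.Analysis"
begin

text \<open>
  The space of dimension \<open>d\<close> is \<open>real ^ 'd\<close> and the one of dimension \<open>2d\<close> is \<open>real ^ ('d + 'd)\<close>;
  the summands \<open>Inl\<close> and \<open>Inr\<close> index the two blocks.
\<close>

definition stack :: "'a ^ 'd \<Rightarrow> 'a ^ 'd \<Rightarrow> 'a ^ ('d::finite + 'd)" where
  "stack x y = (\<chi> i. case i of Inl a \<Rightarrow> x $ a | Inr b \<Rightarrow> y $ b)"

definition upper :: "'a ^ ('d::finite + 'd) \<Rightarrow> 'a ^ 'd" where
  "upper z = (\<chi> i. z $ Inl i)"

definition lower :: "'a ^ ('d::finite + 'd) \<Rightarrow> 'a ^ 'd" where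
  "lower z = (\<chi> i. z $ Inr i)"

definition block_matrix ::
  "'a ^ 'd ^ 'd \<Rightarrow> 'a ^ 'd ^ 'd \<Rightarrow> 'a ^ 'd ^ 'd \<Rightarrow> 'a ^ 'd ^ 'd \<Rightarrow> 'a ^ ('d::finite + 'd) ^ ('d + 'd)" where
  "block_matrix A B C D =
     (\<chi> i. case i of Inl a \<Rightarrow> stack (A $ a) (B $ a) | Inr a \<Rightarrow> stack (C $ a) (D $ a))"

definition std_symplectic :: "real ^ ('d::finite + 'd) ^ ('d + 'd)" where
  "std_symplectic = block_matrix 0 (mat 1) (- mat 1) 0"

definition symplectic :: "real ^ ('d::finite + 'd) ^ ('d + 'd) \<Rightarrow> bool" where
  "symplectic M \<longleftrightarrow> transpose M ** std_symplectic ** M = std_symplectic"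

definition swap_matrix :: "real ^ ('d::finite + 'd) ^ ('d + 'd)" where
  "swap_matrix = block_matrix 0 (mat 1) (mat 1) 0"

definition conj_transpose :: "complex ^ 'd ^ 'd \<Rightarrow> complex ^ 'd ^ ('d::finite)" where
  "conj_transpose V = (\<chi> i j. cnj (V $ j $ i))"

definition unitary_matrix :: "complex ^ 'd ^ ('d::finite) \<Rightarrow> bool" where
  "unitary_matrix V \<longleftrightarrow> conj_transpose V ** V = mat 1 \<and> V ** conj_transpose V = mat 1"

definition real_valued_matrix :: "complex ^ 'd ^ ('d::finite) \<Rightarrow> bool" where
  "real_valued_matrix V \<longleftrightarrow> (\<forall>i j. V $ i $ j \<in> \<real>)"

definition symplectic_rotation :: "complex ^ 'd ^ 'd \<Rightarrow> real ^ ('d::finite + 'd) ^ ('d + 'd)" where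
  "symplectic_rotation V =
     (let A = (\<chi> i j. Re (V $ i $ j)); B = (\<chi> i j. Im (V $ i $ j))
      in block_matrix A B (- B) A)"

definition tensor ::
  "(real ^ 'd \<Rightarrow> 'b) \<Rightarrow> (real ^ 'd \<Rightarrow> 'b) \<Rightarrow> real ^ ('d::finite + 'd) \<Rightarrow> 'b::times" where
  "tensor f g z = f (upper z) * g (lower z)"

definition dilation ::
  "real ^ 'n ^ 'n \<Rightarrow> (real ^ 'n \<Rightarrow> 'b) \<Rightarrow> real ^ ('n::finite) \<Rightarrow> 'b::real_vector" where
  "dilation L F x = (\<bar>det L\<bar> powr (- 1 / 2)) *\<^sub>R F (matrix_inv L *v x)"

text \<open>
  Elements of \<open>L\<^sup>2\<close> are represented by functions, and an operator on \<open>L\<^sup>2\<close> by a map between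
  representatives; identities between elements of \<open>L\<^sup>2\<close> are therefore stated almost everywhere.
\<close>

definition L2 :: "(real ^ ('d::finite) \<Rightarrow> complex) \<Rightarrow> bool" where
  "L2 f \<longleftrightarrow> f \<in> borel_measurable lborel \<and> integrable lborel (\<lambda>x. (cmod (f x))\<^sup>2)"

definition L2_inner ::
  "(real ^ 'd \<Rightarrow> complex) \<Rightarrow> (real ^ ('d::finite) \<Rightarrow> complex) \<Rightarrow> complex" where
  "L2_inner f g = (\<integral>x. f x * cnj (g x) \<partial>lborel)"

text \<open>
  Linearity together with preservation of inner products forces \<open>T\<close> to map almost everywhere
  equal functions to almost everywhere equal functions, so \<open>T\<close> does act on classes.
\<close>

definition unitary_L2 ::
  "((real ^ 'd \<Rightarrow> complex) \<Rightarrow> real ^ ('d::finite) \<Rightarrow> complex) \<Rightarrow> bool" where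
  "unitary_L2 T \<longleftrightarrow>
     (\<forall>f. L2 f \<longrightarrow> L2 (T f)) \<and>
     (\<forall>a b f g. L2 f \<longrightarrow> L2 g \<longrightarrow>
        (AE x in lborel. T (\<lambda>t. a * f t + b * g t) x = a * T f x + b * T g x)) \<and>
     (\<forall>f g. L2 f \<longrightarrow> L2 g \<longrightarrow> L2_inner (T f) (T g) = L2_inner f g) \<and>
     (\<forall>g. L2 g \<longrightarrow> (\<exists>f. L2 f \<and> (AE x in lborel. T f x = g x)))"

definition time_freq_shift ::
  "real ^ ('d + 'd) \<Rightarrow> (real ^ 'd \<Rightarrow> complex) \<Rightarrow> real ^ ('d::finite) \<Rightarrow> complex" where
  "time_freq_shift z f t =
     cis (- pi * (upper z \<bullet> lower z)) * cis (2 * pi * (lower z \<bullet> t)) * f (t - upper z)"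

text \<open>
  The intertwining relation \<open>\<rho>(M z) = T \<rho>(z) T\<inverse>\<close> is written in the form \<open>\<rho>(M z) T = T \<rho>(z)\<close>,
  since \<open>T\<close> is invertible only up to almost everywhere equality.
\<close>

definition metaplectic ::
  "real ^ ('d + 'd) ^ ('d + 'd) \<Rightarrow> ((real ^ 'd \<Rightarrow> complex) \<Rightarrow> real ^ ('d::finite) \<Rightarrow> complex) \<Rightarrow> bool"
where
  "metaplectic M T \<longleftrightarrow> unitary_L2 T \<and>
     (\<forall>z f. L2 f \<longrightarrow>
        (AE t in lborel. time_freq_shift (M *v z) (T f) t = T (time_freq_shift z f) t))"

text \<open>The first \<open>k\<close> coordinates with respect to the linear order of the index type.\<close>

definition first_coords :: "nat \<Rightarrow> 'd::{finite,linorder} set" where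
  "first_coords k = {i. card {j. j < i} < k}"

text \<open>
  The integral over the first \<open>k\<close> variables is taken with respect to the product of \<open>k\<close> copies of
  Lebesgue measure; the other coordinates of the argument of \<open>f\<close> are those of \<open>w\<close>.
\<close>

definition partial_fourier_integral ::
  "nat \<Rightarrow> (real ^ ('d::{finite,linorder}) \<Rightarrow> complex) \<Rightarrow> real ^ ('d::{finite,linorder}) \<Rightarrow> complex" where
  "partial_fourier_integral k f w =
     (\<integral>x. f (\<chi> i. if i \<in> first_coords k then x i else w $ i)
            * cis (- 2 * pi * (\<Sum>i\<in>first_coords k. w $ i * x i))
        \<partial>(\<Pi>\<^sub>M i\<in>first_coords k. lborel))"

text \<open>
  The unitary extension of the integral transform from the dense subspace of integrable functions
  in \<open>L\<^sup>2\<close>; by density it is determined up to almost everywhere equality.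
\<close>

definition partial_fourier ::
  "nat \<Rightarrow> ((real ^ ('d::{finite,linorder}) \<Rightarrow> complex) \<Rightarrow> real ^ ('d::{finite,linorder}) \<Rightarrow> complex) \<Rightarrow> bool" where
  "partial_fourier k T \<longleftrightarrow> unitary_L2 T \<and>
     (\<forall>f. L2 f \<longrightarrow> integrable lborel f \<longrightarrow>
        (AE w in lborel. T f w = partial_fourier_integral k f w))"

end

theory Submission
  imports Defs "HOL-Complex_Analysis.Complex_Analysis"
begin

text \<open>
  The factorization of \<open>\<bar>f\<bar> \<otimes> \<bar>RV_op f\<bar>\<close> and the linear substitution \<open>z = \<Omega> w\<close> turn the hypothesis into a
  statement about \<open>g = B_op f\<close> alone: since \<open>w \<bullet> (swap_matrix *v w) = 2 * (x \<bullet> y)\<close> for \<open>w = (x, y)\<close>, it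
  says that \<open>\<integral>\<integral> \<bar>g x\<bar> * \<bar>F_k g y\<bar> * exp (2 * pi * \<bar>x \<bullet> y\<bar>)\<close> is finite. This is the hypothesis of Beurling's
  uncertainty principle, with a partial Fourier transform in place of the full one. Once \<open>g\<close> is known
  to vanish, so does \<open>f\<close>, because \<open>B_op\<close> is unitary.

  For the full transform \<open>H\<close> of \<open>G\<close>, consider
  \<open>\<Phi> z = \<integral>\<integral> cnj (G x) * H y * exp (2 * pi * \<i> * z * (x \<bullet> y))\<close>. It is holomorphic and bounded on the
  strip \<open>\<bar>Im z\<bar> < 1\<close>, and for real \<open>t\<close> it equals \<open>\<integral> H y * cnj (H (t * y))\<close>, so that
  \<open>\<Phi> (1 / t) = \<bar>t\<bar> ^ n * cnj (\<Phi> t)\<close> in dimension \<open>n\<close>. By this symmetry \<open>\<Phi>\<^sup>2\<close> extends to a bounded function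
  on the plane without \<open>\<plusminus>\<i>\<close> that decays along the imaginary axis, and Liouville's theorem gives
  \<open>\<Phi> = 0\<close> (\<open>inversion_symmetric_on_strip_vanishes\<close>). In particular \<open>\<Phi> 1 = \<integral> \<bar>H y\<bar>\<^sup>2\<close> is \<open>0\<close>
  (\<open>beurling_lebesgue_product\<close>).

  The partial transform is reduced to the full one in the transformed coordinates by averaging over
  the remaining coordinates against a Gaussian, which absorbs their contribution to \<open>x \<bullet> y\<close>
  (\<open>partial_beurling_lebesgue_product\<close>).
\<close>

section \<open>Bounded functions on a strip with an inversion symmetry\<close>

text \<open>
  The domain is the right half of the overlap of the strip with its image under \<open>z \<mapsto> 1 / z\<close>.
  It is connected because moving to the right never leaves it and eventually leads into a convex
  half strip; the identity theorem then propagates the zeros on the positive real axis.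
\<close>

lemma vanishes_on_right_overlap:
  fixes f :: "complex \<Rightarrow> complex"
  assumes hol: "f holomorphic_on {z. Re z > 0 \<and> \<bar>Im z\<bar> < 1 \<and> \<bar>Im z\<bar> < (cmod z)\<^sup>2}"
    and zero: "\<And>t::real. t > 0 \<Longrightarrow> f (of_real t) = 0"
    and z: "Re z > 0" "\<bar>Im z\<bar> < 1" "\<bar>Im z\<bar> < (cmod z)\<^sup>2"
  shows "f z = 0"
proof -
  define W where "W = {z. Re z > 0 \<and> \<bar>Im z\<bar> < 1 \<and> \<bar>Im z\<bar> < (cmod z)\<^sup>2}"
  define H where "H = {z. Re z > 1 \<and> \<bar>Im z\<bar> < 1}"
  have "open W" unfolding W_def
    by (intro open_Collect_conj open_Collect_less continuous_intros)
  have H_eq: "H = {z. 1 < Re z} \<inter> {z. Im z < 1} \<inter> {z. -1 < Im z}"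
    by (auto simp: H_def)
  have "convex H" unfolding H_eq
    by (intro convex_Int convex_halfspace_Re_gt convex_halfspace_Im_lt convex_halfspace_Im_gt)
  have HW: "H \<subseteq> W"
  proof
    fix w assume w: "w \<in> H"
    then have "1 < (Re w)\<^sup>2" by (simp add: H_def one_less_power)
    then have "1 < (cmod w)\<^sup>2" unfolding cmod_power2 using zero_le_power2[of "Im w"] by linarith
    with w show "w \<in> W" by (auto simp: H_def W_def)
  qed
  define ray where "ray = (\<lambda>w::complex. (\<lambda>t::real. w + of_real t) ` {0..})"
  have ray_sub: "ray w \<subseteq> W" if "w \<in> W" for w
  proof
    fix v assume "v \<in> ray w"
    then obtain t where t: "t \<ge> 0" "v = w + of_real t" by (auto simp: ray_def)
    have "(Re w)\<^sup>2 \<le> (Re v)\<^sup>2" using that t by (intro power_mono) (auto simp: W_def)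
    then have "(cmod w)\<^sup>2 \<le> (cmod v)\<^sup>2" using t by (simp add: cmod_power2)
    moreover have "\<bar>Im v\<bar> < (cmod w)\<^sup>2" using that t by (simp add: W_def)
    ultimately have "\<bar>Im v\<bar> < (cmod v)\<^sup>2" by (rule less_le_trans[rotated])
    with that t show "v \<in> W" by (simp add: W_def)
  qed
  have conn_ray: "connected (ray w)" for w
    unfolding ray_def by (intro connected_continuous_image continuous_intros) simp
  have meets: "H \<inter> ray w \<noteq> {}" if "w \<in> W" for w
  proof -
    have "w + of_real 2 \<in> ray w" unfolding ray_def by (intro imageI) simp
    moreover have "w + of_real 2 \<in> H" using that by (simp add: H_def W_def)
    ultimately show ?thesis by blast
  qed
  have "W = (\<Union>w\<in>W. H \<union> ray w)"
  proof
    have "w \<in> ray w" for w by (auto simp: ray_def intro!: image_eqI[of _ _ 0])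
    then show "W \<subseteq> (\<Union>w\<in>W. H \<union> ray w)" by blast
    show "(\<Union>w\<in>W. H \<union> ray w) \<subseteq> W" using HW ray_sub by blast
  qed
  moreover have "connected (\<Union>w\<in>W. H \<union> ray w)"
  proof (rule connected_Union)
    show "connected S" if "S \<in> (\<lambda>w. H \<union> ray w) ` W" for S
      using that convex_connected[OF \<open>convex H\<close>] conn_ray meets by (auto intro!: connected_Un)
    have "2 \<in> H" by (simp add: H_def)
    then show "\<Inter> ((\<lambda>w. H \<union> ray w) ` W) \<noteq> {}" by blast
  qed
  ultimately have "connected W" by simp
  define U where "U = complex_of_real ` {0<..}"
  have "1 islimpt U"
    unfolding islimpt_approachable
  proof (intro allI impI)
    fix e :: real assume "e > 0"
    moreover have "complex_of_real (1 + e/2) \<in> U" using \<open>e > 0\<close> unfolding U_def by (intro imageI) simp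
    ultimately show "\<exists>x'\<in>U. x' \<noteq> 1 \<and> dist x' 1 < e"
      by (intro bexI[of _ "complex_of_real (1 + e/2)"]) (auto simp: dist_norm norm_mult)
  qed
  moreover have "U \<subseteq> W" by (auto simp: U_def W_def)
  moreover have "1 \<in> W" by (simp add: W_def)
  moreover have "f u = 0" if "u \<in> U" for u using that zero by (auto simp: U_def)
  ultimately show ?thesis
    using analytic_continuation[of f W U 1 z] hol \<open>open W\<close> \<open>connected W\<close> z
    by (simp add: W_def)
qed

text \<open>
  The inversion \<open>z \<mapsto> 1 / z\<close> maps the strip without \<open>0\<close> onto the complement of the two closed discs
  with diameters from \<open>0\<close> to \<open>\<plusminus>\<i>\<close>, so that the strip and its image together miss only \<open>\<plusminus>\<i>\<close>. The symmetry therefore extends the function by reflection to the twice punctured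
  plane. The extension is bounded, so the punctures are removable and Liouville's theorem makes it
  constant; the factor that the reflection introduces forces decay along the imaginary axis, so the
  constant is \<open>0\<close>.

  For odd \<open>n\<close> the factor \<open>\<bar>t\<bar> ^ n\<close> continues to different analytic functions from the two half lines.
  The square of the function has the factor \<open>t ^ (2 * n)\<close> instead, so the argument is run on it.
\<close>

lemma inversion_symmetric_on_strip_vanishes:
  fixes \<Phi> :: "complex \<Rightarrow> complex"
  assumes n: "n > 0"
    and hol: "\<Phi> holomorphic_on {z. \<bar>Im z\<bar> < 1}"
    and bdd: "\<And>z. \<bar>Im z\<bar> < 1 \<Longrightarrow> cmod (\<Phi> z) \<le> C"
    and sym: "\<And>t::real. t \<noteq> 0 \<Longrightarrow> \<Phi> (of_real (1 / t)) = of_real (\<bar>t\<bar> ^ n) * cnj (\<Phi> (of_real t))"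
    and z: "\<bar>Im z\<bar> < 1"
  shows "\<Phi> z = 0"
proof -
  define G where "G = (\<lambda>z. (\<Phi> z)\<^sup>2)"
  \<comment> \<open>the reflection of the square, defined on the image of the strip under inversion\<close>
  define R where "R = (\<lambda>z. (1 / z) ^ (2*n) * cnj (G (cnj (1 / z))))"
  let ?D = "{z. \<bar>Im z\<bar> < (cmod z)\<^sup>2}"
  have Im_inv: "\<bar>Im (1 / z)\<bar> < 1" if "z \<in> ?D" for z
  proof -
    from that have "z \<noteq> 0" by auto
    then have "\<bar>Im (1 / z)\<bar> = \<bar>Im z\<bar> / (cmod z)\<^sup>2"
      by (simp add: Im_divide cmod_power2)
    with that \<open>z \<noteq> 0\<close> show ?thesis by simp
  qed
  have holG: "G holomorphic_on {z. \<bar>Im z\<bar> < 1}"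
    unfolding G_def by (intro holomorphic_intros hol)
  have "open {z. \<bar>Im z\<bar> < 1}" by (intro open_Collect_less continuous_intros)
  have "(cnj \<circ> G \<circ> cnj) holomorphic_on {z. \<bar>Im z\<bar> < 1}"
    using \<open>open {z. \<bar>Im z\<bar> < 1}\<close>
    by (intro holomorphic_on_compose_cnj_cnj) (auto intro: holomorphic_on_subset[OF holG])
  then have "(cnj \<circ> G \<circ> cnj) \<circ> (\<lambda>z. 1 / z) holomorphic_on ?D"
    by (rule holomorphic_on_compose_gen[rotated])
       (use Im_inv in \<open>auto intro!: holomorphic_intros\<close>)
  then have holR: "R holomorphic_on ?D"
    unfolding R_def by (auto simp: o_def intro!: holomorphic_intros)
  have real: "R (of_real t) = G (of_real t)" if "t \<noteq> 0" for t :: real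
  proof -
    have "R (of_real t) = of_real (1 / t) ^ (2*n) * cnj (G (of_real (1 / t)))"
      by (simp add: R_def)
    also have "cnj (G (of_real (1 / t))) = of_real (\<bar>t\<bar> ^ n) ^ 2 * G (of_real t)"
      using sym[OF that] by (simp add: G_def power_mult_distrib)
    also have "of_real (\<bar>t\<bar> ^ n) ^ 2 = (of_real t ^ (2*n) :: complex)"
      by (simp add: power_mult_distrib flip: of_real_power power_mult)
         (simp add: power_mult mult.commute[of n])
    finally show ?thesis using that by (simp add: field_simps)
  qed
  have agree: "R z = G z" if "\<bar>Im z\<bar> < 1" "z \<in> ?D" for z
  proof -
    \<comment> \<open>on the imaginary axis the two domains do not meet, so the overlap has exactly two halves\<close>
    have "Re z \<noteq> 0"
    proof
      assume "Re z = 0"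
      then have "\<bar>Im z\<bar> < \<bar>Im z\<bar>\<^sup>2" using that by (simp add: cmod_power2)
      also have "\<dots> \<le> \<bar>Im z\<bar>"
        using that by (simp add: power2_eq_square mult_left_le_one_le del: abs_mult_self_eq)
      finally show False by simp
    qed
    then consider "Re z > 0" | "Re (- z) > 0" by fastforce
    then show ?thesis
    proof cases
      case 1
      have "(\<lambda>w. R w - G w) z = 0"
        by (rule vanishes_on_right_overlap)
           (use 1 that real in \<open>auto intro!: holomorphic_intros holomorphic_on_subset[OF holR]
              holomorphic_on_subset[OF holG]\<close>)
      then show ?thesis by simp
    next
      case 2
      let ?W = "{z. Re z > 0 \<and> \<bar>Im z\<bar> < 1 \<and> \<bar>Im z\<bar> < (cmod z)\<^sup>2}"
      have "(R \<circ> uminus) holomorphic_on ?W" "(G \<circ> uminus) holomorphic_on ?W"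
        by (rule holomorphic_on_compose_gen[OF _ holR] holomorphic_on_compose_gen[OF _ holG];
            auto intro!: holomorphic_intros)+
      then have "(\<lambda>w. R (- w) - G (- w)) holomorphic_on ?W"
        by (auto simp: o_def intro!: holomorphic_intros)
      then have "(\<lambda>w. R (- w) - G (- w)) (- z) = 0"
        by (rule vanishes_on_right_overlap)
           (use 2 that real[of "- t" for t] in auto)
      then show ?thesis by simp
    qed
  qed
  define E where "E = (\<lambda>z. if \<bar>Im z\<bar> < 1 then G z else R z)"
  have ER: "E z = R z" if "z \<in> ?D" for z using agree that by (auto simp: E_def)
  have cover: "UNIV - {\<i>, - \<i>} = {z. \<bar>Im z\<bar> < 1} \<union> ?D"
  proof -
    have "\<bar>Im z\<bar> < (cmod z)\<^sup>2" if "z \<noteq> \<i>" "z \<noteq> - \<i>" "\<not> \<bar>Im z\<bar> < 1" for z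
    proof (cases "Re z = 0")
      case True
      with that have "\<bar>Im z\<bar> \<noteq> 1" by (auto simp: complex_eq_iff abs_if split: if_splits)
      with that have "1 < \<bar>Im z\<bar>" by simp
      then have "\<bar>Im z\<bar> * 1 < \<bar>Im z\<bar> * \<bar>Im z\<bar>" by (intro mult_strict_left_mono) auto
      then show ?thesis using True unfolding cmod_power2 by (simp add: power2_eq_square)
    next
      case False
      have "\<bar>Im z\<bar> * 1 \<le> \<bar>Im z\<bar> * \<bar>Im z\<bar>" using that by (intro mult_left_mono) auto
      moreover have "0 < (Re z)\<^sup>2" using False by simp
      ultimately show ?thesis unfolding cmod_power2 by (simp add: power2_eq_square)
    qed
    moreover have "\<not> \<bar>Im z\<bar> < (cmod z)\<^sup>2" "\<not> \<bar>Im z\<bar> < 1" if "z = \<i> \<or> z = - \<i>" for z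
      using that by auto
    ultimately show ?thesis by blast
  qed
  have "E holomorphic_on {z. \<bar>Im z\<bar> < 1}"
    using holG by (rule holomorphic_transform) (simp add: E_def)
  moreover have "E holomorphic_on ?D"
    using holR by (rule holomorphic_transform) (simp add: ER)
  moreover have "open ?D" by (intro open_Collect_less continuous_intros)
  ultimately have holE: "E holomorphic_on UNIV - {\<i>, - \<i>}"
    unfolding cover using \<open>open {z. \<bar>Im z\<bar> < 1}\<close> by (intro holomorphic_on_Un)
  have bddG: "cmod (G z) \<le> C\<^sup>2" if "\<bar>Im z\<bar> < 1" for z
    using bdd[OF that] by (simp add: G_def norm_power power_mono)
  have decayR: "cmod (R z) \<le> C\<^sup>2 / cmod z ^ (2*n)" if "z \<in> ?D" for z
  proof -
    have "\<bar>Im (cnj (1 / z))\<bar> < 1" using Im_inv[OF that] by (simp del: complex_cnj_divide)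
    then have "cmod (G (cnj (1 / z))) \<le> C\<^sup>2" by (rule bddG)
    then show ?thesis
      by (simp add: R_def norm_mult norm_power norm_divide power_divide divide_right_mono)
  qed
  have bddE: "cmod (E z) \<le> C\<^sup>2" if "z \<noteq> \<i>" "z \<noteq> - \<i>" for z
  proof (cases "\<bar>Im z\<bar> < 1")
    case True then show ?thesis using bddG by (simp add: E_def)
  next
    case False
    then have "z \<in> ?D" using cover that by blast
    moreover have "1 \<le> cmod z" using False abs_Im_le_cmod[of z] by linarith
    then have "1 \<le> cmod z ^ (2*n)" by (rule one_le_power)
    then have "C\<^sup>2 / cmod z ^ (2*n) \<le> C\<^sup>2 / 1"
      by (intro divide_left_mono) auto
    ultimately show ?thesis using decayR[of z] ER[of z] by simp
  qed
  have "E \<in> O[at w](\<lambda>_. 1)" for w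
  proof (rule bigoI[where c = "C\<^sup>2"])
    have "\<forall>\<^sub>F x in at w. x \<in> - ({\<i>, - \<i>} - {w}) - {w}"
      
      by (rule eventually_at_in_open, rule open_Compl, rule finite_imp_closed) simp_all
    then show "\<forall>\<^sub>F x in at w. norm (E x) \<le> C\<^sup>2 * norm (1::complex)"
      by eventually_elim (use bddE in auto)
  qed
  with holE have "\<exists>K. K holomorphic_on UNIV \<and> (\<forall>z\<in>UNIV - {\<i>, - \<i>}. K z = E z)"
    by (intro removable_singularities) simp_all
  then obtain K where K: "K holomorphic_on UNIV" "\<And>z. z \<noteq> \<i> \<Longrightarrow> z \<noteq> - \<i> \<Longrightarrow> K z = E z"
    by blast
  have "bounded (range K)"
  proof -
    have "range K \<subseteq> insert (K \<i>) (insert (K (- \<i>)) (cball 0 (C\<^sup>2)))"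
    proof
      fix v assume "v \<in> range K"
      then obtain z where "v = K z" by blast
      then show "v \<in> insert (K \<i>) (insert (K (- \<i>)) (cball 0 (C\<^sup>2)))"
        using K(2)[of z] bddE[of z] by (cases "z = \<i> \<or> z = - \<i>") auto
    qed
    then show ?thesis by (rule bounded_subset[rotated]) simp
  qed
  then obtain c where c: "\<And>z. K z = c"
    using Liouville_theorem[OF K(1)] by (auto simp: constant_on_def)
  have "cmod c \<le> C\<^sup>2 / y" if "y > 1" for y :: real
  proof -
    let ?z = "Complex 0 y"
    have y: "?z \<noteq> \<i>" "?z \<noteq> - \<i>" "cmod ?z = y" "\<not> \<bar>Im ?z\<bar> < 1"
      using that by (auto simp: complex_eq_iff cmod_def)
    then have "?z \<in> ?D" using cover by blast
    then have "cmod c \<le> C\<^sup>2 / y ^ (2*n)"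
      using decayR[of ?z] ER[of ?z] K(2)[of ?z] y c by simp
    also have "y ^ 1 \<le> y ^ (2*n)" using n that by (intro power_increasing) auto
    then have "C\<^sup>2 / y ^ (2*n) \<le> C\<^sup>2 / y" using that by (intro divide_left_mono) auto
    finally show ?thesis .
  qed
  then have "eventually (\<lambda>y. cmod c \<le> C\<^sup>2 / y) at_top"
    by (intro eventually_mono[OF eventually_gt_at_top[of 1]])
  moreover have "((\<lambda>y. C\<^sup>2 / y) \<longlongrightarrow> 0) at_top" 
    by (rule tendsto_divide_0[OF tendsto_const filterlim_at_top_imp_at_infinity[OF filterlim_ident]])
  ultimately have "cmod c \<le> 0"
    by (intro tendsto_lowerbound[of _ 0 at_top]) auto
  moreover have "K z = (\<Phi> z)\<^sup>2"
  proof -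
    have "z \<noteq> \<i>" "z \<noteq> - \<i>" using z by auto
    then show ?thesis using z K(2)[of z] by (simp add: E_def G_def)
  qed
  ultimately show ?thesis using c by simp
qed

section \<open>Exponential integrals on a strip\<close>

text \<open>
  The weight \<open>exp (2 * pi * \<bar>s x\<bar>)\<close> is the supremum of the absolute value of the exponential over the
  closed strip. In the open strip it leaves room for the polynomial factor in the difference quotients, which makes
  differentiation under the integral an instance of dominated convergence.
\<close>

lemma
  fixes c :: "'a \<Rightarrow> complex" and s :: "'a \<Rightarrow> real"
  assumes c[measurable]: "c \<in> borel_measurable M" and s[measurable]: "s \<in> borel_measurable M"
    and int: "integrable M (\<lambda>x. cmod (c x) * exp (2 * pi * \<bar>s x\<bar>))"
  shows holomorphic_on_strip_exp_integral: "(\<lambda>z. \<integral>x. c x * exp (2 * pi * \<i> * z * s x) \<partial>M) holomorphic_on {z. \<bar>Im z\<bar> < 1}"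
    and norm_exp_integral_le: "\<And>z. \<bar>Im z\<bar> \<le> 1 \<Longrightarrow>
      cmod (\<integral>x. c x * exp (2 * pi * \<i> * z * s x) \<partial>M) \<le> (\<integral>x. cmod (c x) * exp (2 * pi * \<bar>s x\<bar>) \<partial>M)"
    and integrable_exp_integrand: "\<And>z. \<bar>Im z\<bar> \<le> 1 \<Longrightarrow> integrable M (\<lambda>x. c x * exp (2 * pi * \<i> * z * s x))"
proof -
  define e where "e = (\<lambda>z x. exp (2 * pi * \<i> * z * s x))"
  have e_meas[measurable]: "e z \<in> borel_measurable M" for z unfolding e_def by measurable
  have norm_e: "cmod (e z x) \<le> exp (2 * pi * r * \<bar>s x\<bar>)" if "\<bar>Im z\<bar> \<le> r" for z x r
  proof -
    have "- (Im z * s x) \<le> \<bar>Im z\<bar> * \<bar>s x\<bar>" by (metis abs_ge_minus_self abs_mult)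
    also have "\<dots> \<le> r * \<bar>s x\<bar>" using that by (intro mult_right_mono) auto
    finally have "pi * - (Im z * s x) \<le> pi * (r * \<bar>s x\<bar>)" by (intro mult_left_mono) auto
    then show ?thesis by (simp add: e_def mult_ac)
  qed
  have bnd: "cmod (c x * e z x) \<le> cmod (c x) * exp (2 * pi * \<bar>s x\<bar>)" if "\<bar>Im z\<bar> \<le> 1" for z x
    using norm_e[OF that, of x] by (auto simp: norm_mult intro!: mult_left_mono)
  have inte: "integrable M (\<lambda>x. c x * e z x)" if "\<bar>Im z\<bar> \<le> 1" for z
    using bnd[OF that] by (intro Bochner_Integration.integrable_bound[OF int]) auto
  then show "\<And>z. \<bar>Im z\<bar> \<le> 1 \<Longrightarrow> integrable M (\<lambda>x. c x * exp (2 * pi * \<i> * z * s x))"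
    by (simp add: e_def)
  show "cmod (\<integral>x. c x * exp (2 * pi * \<i> * z * s x) \<partial>M) \<le> (\<integral>x. cmod (c x) * exp (2 * pi * \<bar>s x\<bar>) \<partial>M)"
    if "\<bar>Im z\<bar> \<le> 1" for z
  proof -
    have "cmod (\<integral>x. c x * e z x \<partial>M) \<le> (\<integral>x. cmod (c x * e z x) \<partial>M)" by (rule integral_norm_bound)
    also have "\<dots> \<le> (\<integral>x. cmod (c x) * exp (2 * pi * \<bar>s x\<bar>) \<partial>M)"
      using bnd[OF that] inte[OF that] int by (intro integral_mono) auto
    finally show ?thesis by (simp add: e_def)
  qed
  have "((\<lambda>z. \<integral>x. c x * e z x \<partial>M) has_field_derivative (\<integral>x. c x * (e z x * (2 * pi * \<i> * s x)) \<partial>M)) (at z)"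
    if z: "\<bar>Im z\<bar> < 1" for z
    unfolding DERIV_def tendsto_at_iff_sequentially
  proof (intro allI impI)
    fix X :: "nat \<Rightarrow> complex"
    assume X0: "\<forall>i. X i \<in> UNIV - {0}" and X: "X \<longlonglongrightarrow> 0"
    \<comment> \<open>half of the distance to the boundary is kept to absorb the factor \<open>\<bar>s x\<bar>\<close>\<close>
    define \<delta> where "\<delta> = 1 - \<bar>Im z\<bar>"
    have \<delta>: "\<delta> > 0" using z by (simp add: \<delta>_def)
    have "eventually (\<lambda>i. cmod (X i) < \<delta> / 2) sequentially"
      using X \<delta> unfolding tendsto_iff by (auto dest: spec[of _ "\<delta> / 2"])
    then obtain N where "\<And>i. i \<ge> N \<Longrightarrow> cmod (X i) < \<delta> / 2"
      unfolding eventually_sequentially by blast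
    then have N: "cmod (X (i + N)) < \<delta> / 2" for i by simp
    let ?Y = "\<lambda>i. X (i + N)"
    have Y0: "?Y i \<noteq> 0" for i using X0 by auto
    have "(\<lambda>i. \<integral>x. c x * ((e (z + ?Y i) x - e z x) / ?Y i) \<partial>M) \<longlonglongrightarrow> (\<integral>x. c x * (e z x * (2 * pi * \<i> * s x)) \<partial>M)"
    proof (rule integral_dominated_convergence[where w = "\<lambda>x. 2 / \<delta> * (cmod (c x) * exp (2 * pi * \<bar>s x\<bar>))"])
      show "integrable M (\<lambda>x. 2 / \<delta> * (cmod (c x) * exp (2 * pi * \<bar>s x\<bar>)))" using int by simp
      show "AE x in M. (\<lambda>i. c x * ((e (z + ?Y i) x - e z x) / ?Y i)) \<longlonglongrightarrow> c x * (e z x * (2 * pi * \<i> * s x))"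
      proof (intro AE_I2 tendsto_mult tendsto_const)
        fix x
        have "((\<lambda>z. e z x) has_field_derivative e z x * (2 * pi * \<i> * s x)) (at z)"
          unfolding e_def by (auto intro!: derivative_eq_intros)
        then have "((\<lambda>h. (e (z + h) x - e z x) / h) \<longlongrightarrow> e z x * (2 * pi * \<i> * s x)) (at 0)"
          by (simp add: DERIV_def)
        moreover have "?Y \<longlonglongrightarrow> 0" using X by (rule LIMSEQ_ignore_initial_segment)
        ultimately show "(\<lambda>i. (e (z + ?Y i) x - e z x) / ?Y i) \<longlonglongrightarrow> e z x * (2 * pi * \<i> * s x)"
          using Y0 unfolding tendsto_at_iff_sequentially by (auto simp: o_def dest: spec[of _ ?Y])
      qed
      show "AE x in M. norm (c x * ((e (z + ?Y i) x - e z x) / ?Y i)) \<le> 2 / \<delta> * (cmod (c x) * exp (2 * pi * \<bar>s x\<bar>))" for i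
      proof (intro AE_I2)
        fix x
        let ?a = "\<bar>s x\<bar>"
        have "e (z + ?Y i) x - e z x = e z x * (exp (2 * pi * \<i> * ?Y i * s x) - 1)"
          by (simp add: e_def algebra_simps flip: exp_add)
        then have "cmod (e (z + ?Y i) x - e z x)
            \<le> exp (2 * pi * \<bar>Im z\<bar> * ?a) * (exp (cmod (2 * pi * \<i> * ?Y i * s x)) * cmod (2 * pi * \<i> * ?Y i * s x))"
          using Taylor_exp_field[of "2 * pi * \<i> * ?Y i * s x" 0] norm_e[of z "\<bar>Im z\<bar>" x]
          by (auto simp: norm_mult intro!: mult_mono)
        also have "cmod (2 * pi * \<i> * ?Y i * s x) = 2 * pi * cmod (?Y i) * ?a" by (simp add: norm_mult)
        also have "exp (2 * pi * \<bar>Im z\<bar> * ?a) * (exp (2 * pi * cmod (?Y i) * ?a) * (2 * pi * cmod (?Y i) * ?a))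
            = exp (2 * pi * ?a * (\<bar>Im z\<bar> + cmod (?Y i))) * (2 * pi * ?a) * cmod (?Y i)"
          by (simp add: exp_add algebra_simps)
        also have "\<dots> \<le> exp (2 * pi * ?a * (1 - \<delta> / 2)) * (2 * pi * ?a) * cmod (?Y i)"
        proof -
          have "\<bar>Im z\<bar> + cmod (?Y i) \<le> 1 - \<delta> / 2" using N[of i] by (simp add: \<delta>_def field_simps)
          then show ?thesis by (intro mult_right_mono) (auto intro!: mult_left_mono)
        qed
        also have "exp (2 * pi * ?a * (1 - \<delta> / 2)) * (2 * pi * ?a)
            = 2 / \<delta> * (exp (2 * pi * ?a * (1 - \<delta> / 2)) * (pi * ?a * \<delta>))"
          using \<delta> by simp
        also have "\<dots> \<le> 2 / \<delta> * (exp (2 * pi * ?a * (1 - \<delta> / 2)) * exp (pi * ?a * \<delta>))"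
        proof -
          have "pi * ?a * \<delta> \<le> exp (pi * ?a * \<delta>)"
            using exp_ge_add_one_self[of "pi * ?a * \<delta>"] by linarith
          then show ?thesis using \<delta> by (intro mult_left_mono) auto
        qed
        also have "exp (2 * pi * ?a * (1 - \<delta> / 2)) * exp (pi * ?a * \<delta>) = exp (2 * pi * ?a)"
          by (simp add: algebra_simps flip: exp_add)
        finally have "cmod ((e (z + ?Y i) x - e z x) / ?Y i) \<le> 2 / \<delta> * exp (2 * pi * ?a)"
          using Y0[of i] by (simp add: norm_divide field_simps)
        then have "cmod (c x) * cmod ((e (z + ?Y i) x - e z x) / ?Y i) \<le> cmod (c x) * (2 / \<delta> * exp (2 * pi * ?a))"
          by (intro mult_left_mono) auto
        then show "norm (c x * ((e (z + ?Y i) x - e z x) / ?Y i)) \<le> 2 / \<delta> * (cmod (c x) * exp (2 * pi * ?a))"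
          by (simp add: norm_mult norm_divide mult_ac)
      qed
    qed measurable
    also have "(\<lambda>i. \<integral>x. c x * ((e (z + ?Y i) x - e z x) / ?Y i) \<partial>M)
        = (\<lambda>i. ((\<integral>x. c x * e (z + ?Y i) x \<partial>M) - (\<integral>x. c x * e z x \<partial>M)) / ?Y i)"
    proof
      fix i
      have "\<bar>Im (z + ?Y i)\<bar> \<le> 1"
      proof -
        have "cmod (?Y i) * 2 < 1 - \<bar>Im z\<bar>" using N[of i] by (simp add: \<delta>_def)
        moreover have "\<bar>Im (z + ?Y i)\<bar> \<le> \<bar>Im z\<bar> + \<bar>Im (?Y i)\<bar>" by simp
        moreover have "\<bar>Im (?Y i)\<bar> \<le> cmod (?Y i)" by (rule abs_Im_le_cmod)
        ultimately show ?thesis using norm_ge_zero[of "?Y i"] by linarith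
      qed
      then have "(\<integral>x. c x * e (z + ?Y i) x \<partial>M) - (\<integral>x. c x * e z x \<partial>M)
          = (\<integral>x. c x * e (z + ?Y i) x - c x * e z x \<partial>M)"
        using z by (intro Bochner_Integration.integral_diff[symmetric] inte) auto
      also have "\<dots> / ?Y i = (\<integral>x. (c x * e (z + ?Y i) x - c x * e z x) / ?Y i \<partial>M)" by simp
      finally show "(\<integral>x. c x * ((e (z + ?Y i) x - e z x) / ?Y i) \<partial>M)
          = ((\<integral>x. c x * e (z + ?Y i) x \<partial>M) - (\<integral>x. c x * e z x \<partial>M)) / ?Y i"
        by (simp only: right_diff_distrib times_divide_eq_right)
    qed
    finally show "((\<lambda>h. ((\<integral>x. c x * e (z + h) x \<partial>M) - (\<integral>x. c x * e z x \<partial>M)) / h) \<circ> X)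
        \<longlonglongrightarrow> (\<integral>x. c x * (e z x * (2 * pi * \<i> * s x)) \<partial>M)"
      unfolding o_def by (rule LIMSEQ_offset)
  qed
  then show "(\<lambda>z. \<integral>x. c x * exp (2 * pi * \<i> * z * s x) \<partial>M) holomorphic_on {z. \<bar>Im z\<bar> < 1}"
    unfolding holomorphic_on_def e_def
    by (auto simp: field_differentiable_def intro!: exI intro: has_field_derivative_at_within)
qed

section \<open>Beurling's principle for the full Fourier transform\<close>

text \<open>
  Lebesgue measure on the coordinates in a set \<open>S\<close>. Working with index sets instead of types allows
  a space to be split along any subset of its coordinates.
\<close>

definition lebesgue_product :: "'i set \<Rightarrow> ('i \<Rightarrow> real) measure" where
  "lebesgue_product S = (\<Pi>\<^sub>M i\<in>S. lborel)"

definition pairing :: "'i set \<Rightarrow> ('i \<Rightarrow> real) \<Rightarrow> ('i \<Rightarrow> real) \<Rightarrow> real" where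
  "pairing S x y = (\<Sum>i\<in>S. x i * y i)"

definition product_fourier :: "'i set \<Rightarrow> (('i \<Rightarrow> real) \<Rightarrow> complex) \<Rightarrow> ('i \<Rightarrow> real) \<Rightarrow> complex" where
  "product_fourier S G y = (\<integral>x. G x * cis (- 2 * pi * pairing S y x) \<partial>lebesgue_product S)"

lemma pairing_commute: "pairing S x y = pairing S y x"
  by (simp add: pairing_def mult.commute)

lemma measurable_cis[measurable (raw)]:
  "f \<in> borel_measurable M \<Longrightarrow> (\<lambda>x. cis (f x)) \<in> borel_measurable M"
  unfolding cis_conv_exp by measurable

lemma measurable_cnj[measurable (raw)]:
  "f \<in> borel_measurable M \<Longrightarrow> (\<lambda>x. cnj (f x)) \<in> borel_measurable M"
  by (rule measurable_compose[of f M borel cnj]) (auto intro!: borel_measurable_continuous_onI continuous_intros)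

lemma measurable_pairing[measurable (raw)]:
  assumes [measurable]: "f \<in> measurable M (lebesgue_product S)" "g \<in> measurable M (lebesgue_product S)"
  shows "(\<lambda>x. pairing S (f x) (g x)) \<in> borel_measurable M"
proof -
  have [measurable]: "(\<lambda>x. f x i) \<in> borel_measurable M" "(\<lambda>x. g x i) \<in> borel_measurable M" if "i \<in> S" for i
    using measurable_compose[OF assms(1)[unfolded lebesgue_product_def] measurable_component_singleton[OF that]]
      measurable_compose[OF assms(2)[unfolded lebesgue_product_def] measurable_component_singleton[OF that]] by simp_all
  show ?thesis unfolding pairing_def by (intro borel_measurable_sum borel_measurable_times) auto
qed

lemma product_sigma_finite_lborel: "product_sigma_finite (\<lambda>_. lborel :: real measure)"
  by (rule product_sigma_finite.intro) (rule sigma_finite_lborel)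

lemma sigma_finite_lebesgue_product: "finite S \<Longrightarrow> sigma_finite_measure (lebesgue_product S)"
  unfolding lebesgue_product_def by (rule product_sigma_finite.sigma_finite[OF product_sigma_finite_lborel])

definition dilate :: "'i set \<Rightarrow> real \<Rightarrow> ('i \<Rightarrow> real) \<Rightarrow> 'i \<Rightarrow> real" where
  "dilate S t y = (\<lambda>i\<in>S. t * y i)"

lemma measurable_dilate[measurable]: "dilate S t \<in> measurable (lebesgue_product S) (lebesgue_product S)"
  unfolding dilate_def lebesgue_product_def by measurable

lemma pairing_dilate[simp]:
  "pairing S (dilate S t y) x = t * pairing S y x" "pairing S x (dilate S t y) = t * pairing S x y"
  by (simp_all add: pairing_def dilate_def sum_distrib_left mult_ac)

lemma lebesgue_product_dilate:
  assumes S: "finite S" and t: "t \<noteq> 0"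
  shows "density (distr (lebesgue_product S) (lebesgue_product S) (dilate S t)) (\<lambda>_. ennreal (\<bar>t\<bar> ^ card S))
    = lebesgue_product S"
proof -
  interpret product_sigma_finite "\<lambda>_. lborel :: real measure" by (rule product_sigma_finite_lborel)
  show ?thesis
    unfolding lebesgue_product_def
  proof (rule PiM_eqI[OF S])
    let ?D = "density (distr (lebesgue_product S) (lebesgue_product S) (dilate S t)) (\<lambda>_. ennreal (\<bar>t\<bar> ^ card S))"
    fix A :: "'a \<Rightarrow> real set" assume A: "\<And>i. i \<in> S \<Longrightarrow> A i \<in> sets lborel"
    have A'[measurable]: "Pi\<^sub>E S A \<in> sets (lebesgue_product S)"
      using A S unfolding lebesgue_product_def by (intro sets_PiM_I_finite) auto
    have preimage: "dilate S t -` Pi\<^sub>E S A \<inter> space (lebesgue_product S) = Pi\<^sub>E S (\<lambda>i. (*) t -` A i)"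
      by (auto simp: dilate_def lebesgue_product_def space_PiM PiE_iff)
    have A_vimage: "(*) t -` A i \<in> sets lborel" if "i \<in> S" for i
      using measurable_sets[of "(*) t" borel borel "A i"] A[OF that] by simp
    have one_dim: "emeasure lborel (A i) = ennreal \<bar>t\<bar> * emeasure lborel ((*) t -` A i)" if "i \<in> S" for i
      using A[OF that] by (subst lborel_distr_mult'[OF t]) (simp add: emeasure_density emeasure_distr nn_integral_cmult)
    have "emeasure ?D (Pi\<^sub>E S A)
        = ennreal (\<bar>t\<bar> ^ card S) * emeasure (lebesgue_product S) (Pi\<^sub>E S (\<lambda>i. (*) t -` A i))"
      by (simp add: emeasure_density nn_integral_cmult emeasure_distr preimage)
    also have "\<dots> = (\<Prod>i\<in>S. ennreal \<bar>t\<bar>) * (\<Prod>i\<in>S. emeasure lborel ((*) t -` A i))"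
      using A_vimage unfolding lebesgue_product_def by (subst emeasure_PiM[OF S]) (auto simp: ennreal_power)
    also have "\<dots> = (\<Prod>i\<in>S. emeasure lborel (A i))"
      by (simp add: one_dim prod.distrib)
    finally show "emeasure (density (distr (Pi\<^sub>M S (\<lambda>_. lborel)) (Pi\<^sub>M S (\<lambda>_. lborel)) (dilate S t)) (\<lambda>_. ennreal (\<bar>t\<bar> ^ card S))) (Pi\<^sub>E S A) = (\<Prod>i\<in>S. emeasure lborel (A i))"
      unfolding lebesgue_product_def .
  qed simp
qed

lemma integral_lebesgue_product_dilate:
  fixes \<phi> :: "('i \<Rightarrow> real) \<Rightarrow> complex"
  assumes S: "finite S" and t: "t \<noteq> 0" and [measurable]: "\<phi> \<in> borel_measurable (lebesgue_product S)"
  shows "(\<integral>y. \<phi> y \<partial>lebesgue_product S) = of_real (\<bar>t\<bar> ^ card S) * (\<integral>y. \<phi> (dilate S t y) \<partial>lebesgue_product S)"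
  by (subst lebesgue_product_dilate[OF S t, symmetric])
     (simp add: integral_density integral_distr scaleR_conv_of_real)

text \<open>
  Beurling's uncertainty principle, in Hedenmalm's form. The hypothesis makes
  \<open>\<Phi> z = \<integral>\<integral> cnj (G x) * H y * exp (2 * pi * \<i> * z * (x \<bullet> y))\<close> bounded and holomorphic on the strip. For
  real \<open>t\<close> the inner integral is a conjugated Fourier integral, hence
  \<open>\<Phi> t = \<integral> H y * cnj (H (t * y))\<close>. Substituting \<open>t * y\<close> for \<open>y\<close> yields the inversion symmetry, so \<open>\<Phi>\<close>
  vanishes, and \<open>\<Phi> 1\<close> is the squared norm of \<open>H\<close>.
\<close>

theorem beurling_lebesgue_product:
  fixes G :: "('i \<Rightarrow> real) \<Rightarrow> complex" and S :: "'i set"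
  defines "H \<equiv> product_fourier S G"
  assumes S: "finite S" "S \<noteq> {}" and G: "integrable (lebesgue_product S) G"
    and fin: "(\<integral>\<^sup>+ x. \<integral>\<^sup>+ y. ennreal (cmod (G x) * cmod (H y) * exp (2 * pi * \<bar>pairing S x y\<bar>))
      \<partial>lebesgue_product S \<partial>lebesgue_product S) < \<infinity>"
  shows "AE y in lebesgue_product S. H y = 0"
proof -
  let ?N = "lebesgue_product S"
  interpret N: sigma_finite_measure ?N by (rule sigma_finite_lebesgue_product[OF S(1)])
  interpret P: pair_sigma_finite ?N ?N by unfold_locales
  have [measurable]: "G \<in> borel_measurable ?N" using G by auto
  have H[measurable]: "H \<in> borel_measurable ?N"
    unfolding H_def product_fourier_def[abs_def] by measurable
  have H_dilate: "H (dilate S (1 / t) (dilate S t y)) = H y"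
    if "t \<noteq> 0" for t y
    using that by (simp_all add: H_def product_fourier_def)
  define c where "c = (\<lambda>p. cnj (G (fst p)) * H (snd p))"
  define s where "s = (\<lambda>p. pairing S (fst p) (snd p))"
  have [measurable]: "c \<in> borel_measurable (?N \<Otimes>\<^sub>M ?N)" "s \<in> borel_measurable (?N \<Otimes>\<^sub>M ?N)"
    unfolding c_def s_def by measurable
  have int: "integrable (?N \<Otimes>\<^sub>M ?N) (\<lambda>p. cmod (c p) * exp (2 * pi * \<bar>s p\<bar>))"
  proof (rule integrableI_bounded)
    have "(\<integral>\<^sup>+p. ennreal (norm (cmod (c p) * exp (2 * pi * \<bar>s p\<bar>))) \<partial>(?N \<Otimes>\<^sub>M ?N))
        = (\<integral>\<^sup>+ x. \<integral>\<^sup>+ y. ennreal (cmod (G x) * cmod (H y) * exp (2 * pi * \<bar>pairing S x y\<bar>)) \<partial>?N \<partial>?N)"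
      by (subst N.nn_integral_fst[symmetric]) (simp_all add: c_def s_def norm_mult abs_mult)
    with fin show "(\<integral>\<^sup>+p. ennreal (norm (cmod (c p) * exp (2 * pi * \<bar>s p\<bar>))) \<partial>(?N \<Otimes>\<^sub>M ?N)) < \<infinity>" by simp
  qed measurable
  define \<Phi> where "\<Phi> = (\<lambda>z. \<integral>p. c p * exp (2 * pi * \<i> * z * s p) \<partial>(?N \<Otimes>\<^sub>M ?N))"
  have inner: "(\<integral>x. c (x, y) * exp (2 * pi * \<i> * of_real t * s (x, y)) \<partial>?N) = H y * cnj (H (dilate S t y))"
    for t y
  proof -
    have "(\<integral>x. c (x, y) * exp (2 * pi * \<i> * of_real t * s (x, y)) \<partial>?N)
        = (\<integral>x. H y * cnj (G x * cis (- 2 * pi * pairing S (dilate S t y) x)) \<partial>?N)"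
    proof (intro Bochner_Integration.integral_cong refl)
      fix x
      have "exp (2 * pi * \<i> * of_real t * s (x, y)) = cis (2 * pi * (t * pairing S y x))"
        by (simp add: cis_conv_exp s_def pairing_commute[of S x y] mult_ac)
      also have "\<dots> = cnj (cis (- 2 * pi * pairing S (dilate S t y) x))" by (simp add: cis_cnj)
      finally show "c (x, y) * exp (2 * pi * \<i> * of_real t * s (x, y))
          = H y * cnj (G x * cis (- 2 * pi * pairing S (dilate S t y) x))"
        by (simp add: c_def)
    qed
    also have "\<dots> = H y * cnj (H (dilate S t y))"
      by (simp only: integral_mult_right_zero Bochner_Integration.integral_cnj H_def product_fourier_def)
    finally show ?thesis .
  qed
  have real_int: "integrable (?N \<Otimes>\<^sub>M ?N) (\<lambda>p. c p * exp (2 * pi * \<i> * of_real t * s p))" for t :: real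
    by (rule integrable_exp_integrand[OF _ _ int]) simp_all
  have \<Phi>_real: "\<Phi> (of_real t) = (\<integral>y. H y * cnj (H (dilate S t y)) \<partial>?N)" for t :: real
    unfolding \<Phi>_def inner[symmetric]
    using real_int[of t] by (subst P.integral_snd) (simp_all add: split_beta')
  have sym: "\<Phi> (of_real (1 / t)) = of_real (\<bar>t\<bar> ^ card S) * cnj (\<Phi> (of_real t))" if t: "t \<noteq> 0" for t :: real
  proof -
    have "\<Phi> (of_real (1 / t)) = (\<integral>y. H y * cnj (H (dilate S (1 / t) y)) \<partial>?N)" by (rule \<Phi>_real)
    also have "\<dots> = of_real (\<bar>t\<bar> ^ card S) * (\<integral>y. H (dilate S t y) * cnj (H y) \<partial>?N)"
      by (subst integral_lebesgue_product_dilate[OF S(1) t]) (simp_all add: H_dilate[OF t])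
    also have "(\<integral>y. H (dilate S t y) * cnj (H y) \<partial>?N) = cnj (\<integral>y. H y * cnj (H (dilate S t y)) \<partial>?N)"
      by (subst Bochner_Integration.integral_cnj[symmetric]) (simp add: mult.commute)
    finally show ?thesis by (simp only: \<Phi>_real)
  qed
  have "\<Phi> 1 = 0"
  proof (rule inversion_symmetric_on_strip_vanishes[where \<Phi> = \<Phi> and z = 1])
    show "card S > 0" using S by (simp add: card_gt_0_iff)
    show "\<Phi> holomorphic_on {z. \<bar>Im z\<bar> < 1}"
      unfolding \<Phi>_def by (rule holomorphic_on_strip_exp_integral[OF _ _ int]) simp_all
    show "cmod (\<Phi> z) \<le> (\<integral>p. cmod (c p) * exp (2 * pi * \<bar>s p\<bar>) \<partial>(?N \<Otimes>\<^sub>M ?N))" if "\<bar>Im z\<bar> < 1" for z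
      unfolding \<Phi>_def using that by (intro norm_exp_integral_le[OF _ _ int]) simp_all
  qed (use sym in simp_all)
  have H1: "H y * cnj (H (dilate S 1 y)) = of_real ((cmod (H y))\<^sup>2)" for y
  proof -
    have "H (dilate S 1 y) = H y" using H_dilate[of 1 y] by (simp add: H_def product_fourier_def)
    then show ?thesis by (simp only: complex_norm_square)
  qed
  have "integrable ?N (\<lambda>y. \<integral>x. c (x, y) * exp (2 * pi * \<i> * of_real 1 * s (x, y)) \<partial>?N)"
    using real_int[of 1] by (intro P.integrable_snd) (simp_all add: split_beta')
  then have "integrable ?N (\<lambda>y. complex_of_real ((cmod (H y))\<^sup>2))" unfolding inner H1 .
  then have "integrable ?N (\<lambda>y. (cmod (H y))\<^sup>2)" by (simp only: complex_of_real_integrable_eq)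
  moreover have "(\<integral>y. (cmod (H y))\<^sup>2 \<partial>?N) = 0"
    using \<open>\<Phi> 1 = 0\<close> \<Phi>_real[of 1] unfolding H1 by (simp del: of_real_power)
  ultimately have "AE y in ?N. (cmod (H y))\<^sup>2 = 0"
    by (subst (asm) integral_nonneg_eq_0_iff_AE) auto
  then show ?thesis by simp
qed

section \<open>Beurling's principle for the transform in some of the coordinates\<close>

text \<open>
  Rectangles form an intersection-stable generator of the product. The sets over which \<open>u\<close> has
  integral \<open>0\<close> are closed under disjoint union and, the whole space being a rectangle, under
  complement.
\<close>

lemma (in pair_sigma_finite) AE_eq_0_if_rectangle_integrals_eq_0:
  fixes u :: "'a \<times> 'b \<Rightarrow> complex"
  assumes u: "integrable (M1 \<Otimes>\<^sub>M M2) u"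
    and rect: "\<And>A B. A \<in> sets M1 \<Longrightarrow> B \<in> sets M2 \<Longrightarrow> (LINT p:A \<times> B|M1 \<Otimes>\<^sub>M M2. u p) = 0"
  shows "AE p in M1 \<Otimes>\<^sub>M M2. u p = 0"
proof (rule P.density_zero[OF u])
  let ?E = "{A \<times> B | A B. A \<in> sets M1 \<and> B \<in> sets M2}"
  let ?I = "\<lambda>C. LINT p:C|M1 \<Otimes>\<^sub>M M2. u p"
  fix C assume "C \<in> sets (M1 \<Otimes>\<^sub>M M2)"
  then have "C \<in> sigma_sets (space M1 \<times> space M2) ?E" by (simp add: sets_pair_measure)
  from Int_stable_pair_measure_generator pair_measure_closed this show "?I C = 0"
  proof (induct rule: sigma_sets_induct_disjoint)
    case (basic C) then show ?case using rect by auto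
  next
    case empty then show ?case by (simp add: set_lebesgue_integral_def)
  next
    case (compl C)
    then have C[measurable]: "C \<in> sets (M1 \<Otimes>\<^sub>M M2)" by (simp add: sets_pair_measure)
    have uC: "set_integrable (M1 \<Otimes>\<^sub>M M2) C u"
      unfolding set_integrable_def using u by (intro integrable_mult_indicator) auto
    have "?I (space M1 \<times> space M2 - C) = (\<integral>p. u p - indicator C p *\<^sub>R u p \<partial>(M1 \<Otimes>\<^sub>M M2))"
      unfolding set_lebesgue_integral_def
      by (intro Bochner_Integration.integral_cong) (auto simp: space_pair_measure indicator_def)
    also have "\<dots> = (\<integral>p. u p \<partial>(M1 \<Otimes>\<^sub>M M2)) - ?I C"
      using u uC unfolding set_integrable_def set_lebesgue_integral_def
      by (rule Bochner_Integration.integral_diff)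
    also have "(\<integral>p. u p \<partial>(M1 \<Otimes>\<^sub>M M2)) = ?I (space M1 \<times> space M2)"
      unfolding set_lebesgue_integral_def
      by (intro Bochner_Integration.integral_cong) (auto simp: space_pair_measure)
    finally show ?case using rect[OF sets.top sets.top] compl by simp
  next
    case (union C)
    then have C: "C i \<in> sets (M1 \<Otimes>\<^sub>M M2)" for i by (auto simp: sets_pair_measure)
    have "set_integrable (M1 \<Otimes>\<^sub>M M2) (\<Union>i. C i) u"
      unfolding set_integrable_def using u C by (intro integrable_mult_indicator) auto
    then have "?I (\<Union>i. C i) = (\<Sum>i. ?I (C i))"
      using C union(1) by (intro lebesgue_integral_countable_add) (auto simp: disjoint_family_on_def)
    then show ?case using union by simp
  qed
qed

lemma pairing_self_nonneg: "0 \<le> pairing S x x"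
  by (simp add: pairing_def sum_nonneg)

lemma ennreal_norm_integral_le_nn_integral:
  fixes f :: "'a \<Rightarrow> complex"
  shows "ennreal (cmod (\<integral>x. f x \<partial>M)) \<le> (\<integral>\<^sup>+x. ennreal (cmod (f x)) \<partial>M)"
  by (cases "integrable M f") (simp_all add: integral_norm_bound_ennreal not_integrable_integral_eq)

text \<open>
  Here only the coordinates in \<open>S\<close> are Fourier transformed, while the weight also contains the
  pairing of the coordinates in \<open>R\<close>. A single pair of slices \<open>g (\<cdot>, x2)\<close> and \<open>h (\<cdot>, y2)\<close> is not
  enough, because the two functions need not be a Fourier pair. Averaging both over the
  untransformed coordinates with the same weight restores this relation:
  \<open>\<integral> \<eta> x2 * g (\<cdot>, x2)\<close> has the Fourier transform \<open>\<integral> \<eta> y2 * h (\<cdot>, y2)\<close>. A Gaussian factor in \<open>\<eta>\<close>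
  absorbs the untransformed part of the pairing, since \<open>2 * \<bar>x2 \<bullet> y2\<bar> \<le> x2 \<bullet> x2 + y2 \<bullet> y2\<close>, so that
  Beurling's principle applies to the averages. As the support of \<open>\<eta>\<close> is arbitrary, all integrals of
  the weighted \<open>h\<close> over rectangles vanish.
\<close>

theorem partial_beurling_lebesgue_product:
  fixes S R :: "'i set" and g :: "('i \<Rightarrow> real) \<times> ('i \<Rightarrow> real) \<Rightarrow> complex"
  defines "M \<equiv> lebesgue_product S \<Otimes>\<^sub>M lebesgue_product R"
    and "h \<equiv> \<lambda>q. product_fourier S (\<lambda>x. g (x, snd q)) (fst q)"
  assumes S: "finite S" "S \<noteq> {}" and R: "finite R"
    and g: "integrable M g" and h: "integrable M h"
    and fin: "(\<integral>\<^sup>+ p. \<integral>\<^sup>+ q. ennreal (cmod (g p) * cmod (h q) *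
      exp (2 * pi * \<bar>pairing S (fst p) (fst q) + pairing R (snd p) (snd q)\<bar>)) \<partial>M \<partial>M) < \<infinity>"
  shows "AE q in M. h q = 0"
proof -
  let ?N1 = "lebesgue_product S" and ?N2 = "lebesgue_product R"
  interpret N1: sigma_finite_measure ?N1 by (rule sigma_finite_lebesgue_product[OF S(1)])
  interpret N2: sigma_finite_measure ?N2 by (rule sigma_finite_lebesgue_product[OF R])
  interpret P: pair_sigma_finite ?N1 ?N2 by unfold_locales
  interpret P': pair_sigma_finite ?N2 ?N1 by unfold_locales
  have [measurable]: "g \<in> borel_measurable (?N1 \<Otimes>\<^sub>M ?N2)" "h \<in> borel_measurable (?N1 \<Otimes>\<^sub>M ?N2)"
    using g h by (auto simp: M_def)
  define w where "w = (\<lambda>x. exp (- pi * pairing R x x))"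
  have [measurable]: "w \<in> borel_measurable ?N2" unfolding w_def by measurable
  have w: "0 < w x" "w x \<le> 1" for x
    using pairing_self_nonneg[of R x] by (auto simp: w_def)
  have gauss: "w x2 * w y2 * exp (2 * pi * \<bar>b\<bar>) \<le> exp (2 * pi * \<bar>b + pairing R x2 y2\<bar>)" for x2 y2 b
  proof -
    have "2 * \<bar>pairing R x2 y2\<bar> \<le> (\<Sum>i\<in>R. 2 * \<bar>x2 i * y2 i\<bar>)"
      unfolding pairing_def by (subst sum_distrib_left[symmetric]) (simp add: sum_abs)
    also have "\<dots> \<le> (\<Sum>i\<in>R. x2 i * x2 i + y2 i * y2 i)"
    proof (rule sum_mono)
      fix i
      show "2 * \<bar>x2 i * y2 i\<bar> \<le> x2 i * x2 i + y2 i * y2 i"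
        using sum_squares_bound[of "\<bar>x2 i\<bar>" "\<bar>y2 i\<bar>"] by (simp add: abs_mult power2_eq_square)
    qed
    also have "\<dots> = pairing R x2 x2 + pairing R y2 y2" by (simp add: pairing_def sum.distrib)
    finally have "2 * \<bar>b\<bar> - pairing R x2 x2 - pairing R y2 y2 \<le> 2 * \<bar>b + pairing R x2 y2\<bar>"
      using abs_triangle_ineq4[of "b + pairing R x2 y2" "pairing R x2 y2"] by simp
    then have "pi * (2 * \<bar>b\<bar> - pairing R x2 x2 - pairing R y2 y2) \<le> pi * (2 * \<bar>b + pairing R x2 y2\<bar>)"
      by (intro mult_left_mono) auto
    then show ?thesis by (simp add: w_def algebra_simps flip: exp_add)
  qed
  have slice: "AE y1 in ?N1. (\<integral>y2. complex_of_real (indicator Q y2 * w y2) * h (y1, y2) \<partial>?N2) = 0"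
    if Q[measurable]: "Q \<in> sets ?N2" for Q
  proof -
    define \<eta> where "\<eta> = (\<lambda>x. indicator Q x * w x)"
    have [measurable]: "\<eta> \<in> borel_measurable ?N2" unfolding \<eta>_def by measurable
    have \<eta>: "0 \<le> \<eta> x" "\<eta> x \<le> w x" "\<eta> x \<le> 1" for x
      using w[of x] by (auto simp: \<eta>_def indicator_def)
    define G where "G = (\<lambda>x1. \<integral>x2. \<eta> x2 * g (x1, x2) \<partial>?N2)"
    have int_\<eta>g: "integrable (?N1 \<Otimes>\<^sub>M ?N2) (\<lambda>p. \<eta> (snd p) * g p)"
    proof (rule Bochner_Integration.integrable_bound[OF g[unfolded M_def]])
      show "AE p in ?N1 \<Otimes>\<^sub>M ?N2. norm (\<eta> (snd p) * g p) \<le> norm (g p)"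
        using \<eta> by (auto simp: norm_mult intro!: mult_left_le_one_le)
    qed measurable
    then have G: "integrable ?N1 G" unfolding G_def using P.integrable_fst'[OF int_\<eta>g] by simp
    have FG: "product_fourier S G y1 = (\<integral>y2. \<eta> y2 * h (y1, y2) \<partial>?N2)" if "y1 \<in> space ?N1" for y1
    proof -
      let ?k = "\<lambda>x1 x2. \<eta> x2 * g (x1, x2) * cis (- 2 * pi * pairing S y1 x1)"
      have int_k: "integrable (?N1 \<Otimes>\<^sub>M ?N2) (case_prod ?k)"
      proof (rule Bochner_Integration.integrable_bound[OF int_\<eta>g])
        show "case_prod ?k \<in> borel_measurable (?N1 \<Otimes>\<^sub>M ?N2)" using that by measurable
      qed (auto simp: norm_mult)
      have "product_fourier S G y1 = (\<integral>x1. \<integral>x2. ?k x1 x2 \<partial>?N2 \<partial>?N1)"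
        by (simp add: product_fourier_def G_def)
      also have "\<dots> = (\<integral>x2. \<integral>x1. ?k x1 x2 \<partial>?N1 \<partial>?N2)"
        by (rule P.Fubini_integral[OF int_k, symmetric])
      also have "\<dots> = (\<integral>x2. \<eta> x2 * h (y1, x2) \<partial>?N2)"
        by (simp add: h_def product_fourier_def mult.assoc)
      finally show ?thesis .
    qed
    have "AE y1 in ?N1. product_fourier S G y1 = 0"
    proof (rule beurling_lebesgue_product[OF S G])
      show "(\<integral>\<^sup>+ x. \<integral>\<^sup>+ y. ennreal (cmod (G x) * cmod (product_fourier S G y) * exp (2 * pi * \<bar>pairing S x y\<bar>))
        \<partial>?N1 \<partial>?N1) < \<infinity>"
      proof (rule le_less_trans[OF _ fin])
        define F where "F = (\<lambda>x1 y1 x2 y2. ennreal (\<eta> x2 * cmod (g (x1, x2)) * (\<eta> y2 * cmod (h (y1, y2)))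
          * exp (2 * pi * \<bar>pairing S x1 y1\<bar>)))"
        \<comment> \<open>bound the averages by the averages of the absolute values, then exchange the two middle integrals\<close>
        have "(\<integral>\<^sup>+ x. \<integral>\<^sup>+ y. ennreal (cmod (G x) * cmod (product_fourier S G y) * exp (2 * pi * \<bar>pairing S x y\<bar>)) \<partial>?N1 \<partial>?N1)
          \<le> (\<integral>\<^sup>+ x1. \<integral>\<^sup>+ y1. \<integral>\<^sup>+ x2. \<integral>\<^sup>+ y2. F x1 y1 x2 y2 \<partial>?N2 \<partial>?N2 \<partial>?N1 \<partial>?N1)"
        proof (intro nn_integral_mono)
          fix x1 y1 assume [measurable]: "x1 \<in> space ?N1" "y1 \<in> space ?N1"
          have "ennreal (cmod (G x1)) \<le> (\<integral>\<^sup>+x2. ennreal (\<eta> x2 * cmod (g (x1, x2))) \<partial>?N2)"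
            unfolding G_def using ennreal_norm_integral_le_nn_integral[of ?N2 "\<lambda>x2. \<eta> x2 * g (x1, x2)"] \<eta>
            by (simp add: norm_mult)
          moreover have "ennreal (cmod (product_fourier S G y1)) \<le> (\<integral>\<^sup>+y2. ennreal (\<eta> y2 * cmod (h (y1, y2))) \<partial>?N2)"
            using FG ennreal_norm_integral_le_nn_integral[of ?N2 "\<lambda>y2. \<eta> y2 * h (y1, y2)"] \<eta>
            by (simp add: norm_mult \<open>y1 \<in> space ?N1\<close>)
          ultimately have "ennreal (cmod (G x1) * cmod (product_fourier S G y1) * exp (2 * pi * \<bar>pairing S x1 y1\<bar>))
            \<le> (\<integral>\<^sup>+x2. ennreal (\<eta> x2 * cmod (g (x1, x2))) \<partial>?N2) * (\<integral>\<^sup>+y2. ennreal (\<eta> y2 * cmod (h (y1, y2))) \<partial>?N2)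
              * ennreal (exp (2 * pi * \<bar>pairing S x1 y1\<bar>))"
            by (simp add: ennreal_mult mult_mono)
          also have "\<dots> = (\<integral>\<^sup>+ x2. \<integral>\<^sup>+ y2. F x1 y1 x2 y2 \<partial>?N2 \<partial>?N2)"
          proof -
            define a where "a = (\<lambda>x2. ennreal (\<eta> x2 * cmod (g (x1, x2))))"
            define b where "b = (\<lambda>y2. ennreal (\<eta> y2 * cmod (h (y1, y2))))"
            define c where "c = ennreal (exp (2 * pi * \<bar>pairing S x1 y1\<bar>))"
            have [measurable]: "a \<in> borel_measurable ?N2" "b \<in> borel_measurable ?N2"
              unfolding a_def b_def by measurable
            have "F x1 y1 x2 y2 = a x2 * (b y2 * c)" for x2 y2
              using \<eta> by (simp add: F_def a_def b_def c_def ennreal_mult mult_ac)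
            then show ?thesis
              unfolding a_def[symmetric] b_def[symmetric] c_def[symmetric]
              by (simp add: nn_integral_cmult nn_integral_multc mult.assoc)
          qed
          finally show "ennreal (cmod (G x1) * cmod (product_fourier S G y1) * exp (2 * pi * \<bar>pairing S x1 y1\<bar>))
            \<le> (\<integral>\<^sup>+ x2. \<integral>\<^sup>+ y2. F x1 y1 x2 y2 \<partial>?N2 \<partial>?N2)" .
        qed
        also have "\<dots> = (\<integral>\<^sup>+ x1. \<integral>\<^sup>+ x2. \<integral>\<^sup>+ y1. \<integral>\<^sup>+ y2. F x1 y1 x2 y2 \<partial>?N2 \<partial>?N1 \<partial>?N2 \<partial>?N1)"
          by (intro nn_integral_cong P'.Fubini') (simp add: F_def)
        also have "\<dots> \<le> (\<integral>\<^sup>+ x1. \<integral>\<^sup>+ x2. \<integral>\<^sup>+ y1. \<integral>\<^sup>+ y2. ennreal (cmod (g (x1, x2)) * cmod (h (y1, y2)) *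
            exp (2 * pi * \<bar>pairing S x1 y1 + pairing R x2 y2\<bar>)) \<partial>?N2 \<partial>?N1 \<partial>?N2 \<partial>?N1)"
        proof (intro nn_integral_mono)
          fix x1 x2 y1 y2
          have "\<eta> x2 * \<eta> y2 * exp (2 * pi * \<bar>pairing S x1 y1\<bar>) \<le> w x2 * w y2 * exp (2 * pi * \<bar>pairing S x1 y1\<bar>)"
            using \<eta>[of x2] \<eta>[of y2] by (intro mult_right_mono mult_mono) (auto intro: order_trans)
          also have "\<dots> \<le> exp (2 * pi * \<bar>pairing S x1 y1 + pairing R x2 y2\<bar>)" by (rule gauss)
          finally have "cmod (g (x1, x2)) * cmod (h (y1, y2)) * (\<eta> x2 * \<eta> y2 * exp (2 * pi * \<bar>pairing S x1 y1\<bar>))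
            \<le> cmod (g (x1, x2)) * cmod (h (y1, y2)) * exp (2 * pi * \<bar>pairing S x1 y1 + pairing R x2 y2\<bar>)"
            by (intro mult_left_mono) auto
          then show "F x1 y1 x2 y2 \<le> ennreal (cmod (g (x1, x2)) * cmod (h (y1, y2)) *
            exp (2 * pi * \<bar>pairing S x1 y1 + pairing R x2 y2\<bar>))"
            unfolding F_def by (intro ennreal_leI) (simp add: mult_ac)
        qed
        also have "\<dots> = (\<integral>\<^sup>+ p. \<integral>\<^sup>+ q. ennreal (cmod (g p) * cmod (h q) *
            exp (2 * pi * \<bar>pairing S (fst p) (fst q) + pairing R (snd p) (snd q)\<bar>)) \<partial>M \<partial>M)"
        proof -
          define K where "K = (\<lambda>p q. ennreal (cmod (g p) * cmod (h q) *
            exp (2 * pi * \<bar>pairing S (fst p) (fst q) + pairing R (snd p) (snd q)\<bar>)))"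
          have [measurable]: "(\<lambda>(p, q). K p q) \<in> borel_measurable ((?N1 \<Otimes>\<^sub>M ?N2) \<Otimes>\<^sub>M (?N1 \<Otimes>\<^sub>M ?N2))"
            unfolding K_def by measurable
          have "(\<integral>\<^sup>+ p. \<integral>\<^sup>+ q. K p q \<partial>M \<partial>M) = (\<integral>\<^sup>+ x1. \<integral>\<^sup>+ x2. \<integral>\<^sup>+ q. K (x1, x2) q \<partial>M \<partial>?N2 \<partial>?N1)"
            unfolding M_def by (rule N2.nn_integral_fst[symmetric]) measurable
          also have "\<dots> = (\<integral>\<^sup>+ x1. \<integral>\<^sup>+ x2. \<integral>\<^sup>+ y1. \<integral>\<^sup>+ y2. K (x1, x2) (y1, y2) \<partial>?N2 \<partial>?N1 \<partial>?N2 \<partial>?N1)"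
            unfolding M_def by (intro nn_integral_cong N2.nn_integral_fst[symmetric]) measurable
          finally show ?thesis by (simp add: K_def)
        qed
        finally show "(\<integral>\<^sup>+ x. \<integral>\<^sup>+ y. ennreal (cmod (G x) * cmod (product_fourier S G y) * exp (2 * pi * \<bar>pairing S x y\<bar>)) \<partial>?N1 \<partial>?N1)
          \<le> (\<integral>\<^sup>+ p. \<integral>\<^sup>+ q. ennreal (cmod (g p) * cmod (h q) *
            exp (2 * pi * \<bar>pairing S (fst p) (fst q) + pairing R (snd p) (snd q)\<bar>)) \<partial>M \<partial>M)" .
      qed
    qed
    with AE_space show ?thesis by eventually_elim (simp add: FG \<eta>_def)
  qed
  have "AE q in M. w (snd q) * h q = 0"
    unfolding M_def
  proof (rule P.AE_eq_0_if_rectangle_integrals_eq_0)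
    show int_wh: "integrable (?N1 \<Otimes>\<^sub>M ?N2) (\<lambda>q. w (snd q) * h q)"
    proof (rule Bochner_Integration.integrable_bound[OF h[unfolded M_def]])
      show "AE q in ?N1 \<Otimes>\<^sub>M ?N2. norm (w (snd q) * h q) \<le> norm (h q)"
        using w by (auto simp: norm_mult less_imp_le intro!: mult_left_le_one_le)
    qed measurable
    fix A Q assume A[measurable]: "A \<in> sets ?N1" and Q[measurable]: "Q \<in> sets ?N2"
    let ?u = "\<lambda>q. indicator (A \<times> Q) q *\<^sub>R (w (snd q) * h q)"
    have "integrable (?N1 \<Otimes>\<^sub>M ?N2) ?u" using int_wh by (intro integrable_mult_indicator) auto
    then have "(LINT q:A \<times> Q|?N1 \<Otimes>\<^sub>M ?N2. w (snd q) * h q) = (\<integral>y1. \<integral>y2. ?u (y1, y2) \<partial>?N2 \<partial>?N1)"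
      unfolding set_lebesgue_integral_def by (subst P.integral_fst') auto
    also have "\<dots> = (\<integral>y1. complex_of_real (indicator A y1) * (\<integral>y2. complex_of_real (indicator Q y2 * w y2) * h (y1, y2) \<partial>?N2) \<partial>?N1)"
      by (intro Bochner_Integration.integral_cong)
         (auto simp: indicator_times scaleR_conv_of_real mult_ac simp flip: integral_mult_right_zero)
    also have "\<dots> = 0" using slice[OF Q] by (intro integral_eq_zero_AE) auto
    finally show "(LINT q:A \<times> Q|?N1 \<Otimes>\<^sub>M ?N2. w (snd q) * h q) = 0" .
  qed
  then show ?thesis
  proof eventually_elim
    case (elim q) then show ?case using w(1)[of "snd q"] by auto
  qed
qed

section \<open>Lebesgue measure under linear maps and splittings of coordinates\<close>

lemma nn_integral_lborel_translate:
  fixes F :: "'a::euclidean_space \<Rightarrow> ennreal"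
  assumes [measurable]: "F \<in> borel_measurable borel"
  shows "(\<integral>\<^sup>+x. F (c + x) \<partial>lborel) = (\<integral>\<^sup>+x. F x \<partial>lborel)"
proof -
  have "(\<integral>\<^sup>+x. F x \<partial>lborel) = (\<integral>\<^sup>+x. F x \<partial>distr lborel borel ((+) c))"
    by (simp only: lborel_distr_plus)
  also have "\<dots> = (\<integral>\<^sup>+x. F (c + x) \<partial>lborel)" by (simp add: nn_integral_distr)
  finally show ?thesis ..
qed

text \<open>
  The image of Lebesgue measure under \<open>L\<close> is invariant under translations, and the usual uniqueness
  argument for Haar measure compares it with Lebesgue measure: both are tested against a ball,
  and Fubini together with two translations moves the map from \<open>F\<close> to the ball. The integrals of
  \<open>F\<close> and \<open>F \<circ> L\<close> are thus in the ratio of the measures of \<open>B\<close> and \<open>L -` B\<close>, the latter of which is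
  nonzero because \<open>L -` B\<close> is open and nonempty.
\<close>

lemma nn_integral_linear_image_finite:
  fixes F :: "'a::euclidean_space \<Rightarrow> ennreal" and L K :: "'a \<Rightarrow> 'a"
  assumes [measurable]: "F \<in> borel_measurable borel" and L: "linear L" and LK: "\<And>y. L (K y) = y"
    and fin: "(\<integral>\<^sup>+x. F (L x) \<partial>lborel) < \<infinity>"
  shows "(\<integral>\<^sup>+x. F x \<partial>lborel) < \<infinity>"
proof -
  define B where "B = ball (0::'a) 1"
  have [measurable]: "B \<in> sets borel" by (simp add: B_def)
  have contL: "continuous_on UNIV L" using L by (rule linear_continuous_on_compose[OF continuous_on_id, simplified])
  have [measurable]: "L \<in> borel_measurable borel" by (rule borel_measurable_continuous_onI[OF contL])
  have "open (L -` B)" using contL by (rule open_vimage[rotated]) (simp add: B_def)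
  moreover from this have [measurable]: "L -` B \<in> sets borel" by simp
  moreover have "0 \<in> L -` B" by (simp add: linear_0[OF L] B_def)
  then have "L -` B \<noteq> {}" by blast
  ultimately have pos: "emeasure lborel (L -` B) \<noteq> 0"
    using open_not_negligible[of "L -` B"]
    by (auto simp: negligible_iff_null_sets null_setsI intro: null_sets_completionI)
  have "(\<integral>\<^sup>+x. F (L x) \<partial>lborel) * emeasure lborel B
      = (\<integral>\<^sup>+x. \<integral>\<^sup>+y. F (L x) * indicator B y \<partial>lborel \<partial>lborel)"
    by (simp add: nn_integral_cmult_indicator nn_integral_multc)
  also have "\<dots> = (\<integral>\<^sup>+x. \<integral>\<^sup>+y. F (L x) * indicator B (- L x + y) \<partial>lborel \<partial>lborel)"
    by (rule nn_integral_cong, rule nn_integral_lborel_translate[symmetric]) measurable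
  also have "\<dots> = (\<integral>\<^sup>+y. \<integral>\<^sup>+x. F (L x) * indicator B (- L x + y) \<partial>lborel \<partial>lborel)"
    by (rule lborel_pair.Fubini') measurable
  also have "\<dots> = (\<integral>\<^sup>+y. \<integral>\<^sup>+x. F (L (K y + x)) * indicator B (- L (K y + x) + y) \<partial>lborel \<partial>lborel)"
    by (rule nn_integral_cong, rule nn_integral_lborel_translate[symmetric]) measurable
  also have "\<dots> = (\<integral>\<^sup>+y. \<integral>\<^sup>+x. F (L x + y) * indicator (L -` B) x \<partial>lborel \<partial>lborel)"
    by (intro nn_integral_cong) (simp add: linear_add[OF L] LK add.commute indicator_def B_def)
  also have "\<dots> = (\<integral>\<^sup>+x. \<integral>\<^sup>+y. F (L x + y) * indicator (L -` B) x \<partial>lborel \<partial>lborel)"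
    by (rule lborel_pair.Fubini') measurable
  also have "\<dots> = (\<integral>\<^sup>+x. (\<integral>\<^sup>+y. F y \<partial>lborel) * indicator (L -` B) x \<partial>lborel)"
    by (intro nn_integral_cong) (simp add: nn_integral_multc nn_integral_lborel_translate)
  also have "\<dots> = (\<integral>\<^sup>+y. F y \<partial>lborel) * emeasure lborel (L -` B)"
    by (simp add: nn_integral_cmult_indicator)
  finally have eq: "(\<integral>\<^sup>+x. F (L x) \<partial>lborel) * emeasure lborel B
      = (\<integral>\<^sup>+y. F y \<partial>lborel) * emeasure lborel (L -` B)" .
  have "(\<integral>\<^sup>+x. F (L x) \<partial>lborel) * emeasure lborel B < \<infinity>"
    using fin emeasure_lborel_ball_finite[of "0::'a" 1] by (simp add: ennreal_mult_less_top B_def)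
  then have "(\<integral>\<^sup>+y. F y \<partial>lborel) * emeasure lborel (L -` B) < \<infinity>" unfolding eq .
  then have "(\<integral>\<^sup>+y. F y \<partial>lborel) = 0 \<or> emeasure lborel (L -` B) = 0 \<or> (\<integral>\<^sup>+y. F y \<partial>lborel) < \<infinity>"
    unfolding infinity_ennreal_def ennreal_mult_less_top by blast
  with pos show ?thesis by (elim disjE) simp_all
qed

definition join_coords :: "'d set \<Rightarrow> ('d \<Rightarrow> real) \<times> ('d \<Rightarrow> real) \<Rightarrow> real ^ 'd" where
  "join_coords S p = (\<chi> i. if i \<in> S then fst p i else snd p i)"

lemma prod_Basis_cart: "(\<Prod>b\<in>Basis. (x :: real ^ 'd) \<bullet> b) = (\<Prod>i\<in>UNIV. x $ i)"
  by (simp add: Basis_vec_def UNION_singleton_eq_range prod.reindex axis_eq_axis inj_on_def inner_axis)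

lemma measurable_join_coords[measurable]:
  fixes S :: "'d::finite set"
  shows "join_coords S \<in> borel_measurable (lebesgue_product S \<Otimes>\<^sub>M lebesgue_product (- S))"
proof -
  have "(\<lambda>p. fst p i) \<in> borel_measurable (lebesgue_product S \<Otimes>\<^sub>M lebesgue_product (- S))" if "i \<in> S" for i
    unfolding lebesgue_product_def using that by measurable
  moreover have "(\<lambda>p. snd p i) \<in> borel_measurable (lebesgue_product S \<Otimes>\<^sub>M lebesgue_product (- S))" if "i \<in> - S" for i
    unfolding lebesgue_product_def using that by measurable
  ultimately have "(\<lambda>p. join_coords S p $ i) \<in> borel_measurable (lebesgue_product S \<Otimes>\<^sub>M lebesgue_product (- S))" for i
    by (cases "i \<in> S") (simp_all add: join_coords_def)
  then show ?thesis
    by (subst borel_measurable_euclidean_space) (auto simp: Basis_vec_def inner_axis)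
qed

lemma distr_join_coords:
  fixes S :: "'d::finite set"
  shows "distr (lebesgue_product S \<Otimes>\<^sub>M lebesgue_product (- S)) borel (join_coords S) = lborel"
proof (rule lborel_eqI[symmetric])
  interpret N: sigma_finite_measure "lebesgue_product (- S)" by (rule sigma_finite_lebesgue_product) simp
  interpret product_sigma_finite "\<lambda>_. lborel :: real measure" by (rule product_sigma_finite_lborel)
  fix l u :: "real ^ 'd" assume "\<And>b. b \<in> Basis \<Longrightarrow> l \<bullet> b \<le> u \<bullet> b"
  then have le: "l $ i \<le> u $ i" for i by (metis axis_in_Basis_iff cart_eq_inner_axis real_inner_1_right Basis_real_def insertI1)
  let ?I = "\<lambda>i. {l $ i <..< u $ i}"
  have preimage: "join_coords S -` box l u \<inter> space (lebesgue_product S \<Otimes>\<^sub>M lebesgue_product (- S))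
      = Pi\<^sub>E S ?I \<times> Pi\<^sub>E (- S) ?I"
    by (auto simp: join_coords_def mem_box_cart space_pair_measure lebesgue_product_def space_PiM PiE_iff
        split: if_splits)
  have PiE: "Pi\<^sub>E T ?I \<in> sets (lebesgue_product T)" "emeasure (lebesgue_product T) (Pi\<^sub>E T ?I) = (\<Prod>i\<in>T. ennreal (u $ i - l $ i))" for T
    unfolding lebesgue_product_def using le by (auto intro!: sets_PiM_I_finite simp: emeasure_PiM)
  have "emeasure (distr (lebesgue_product S \<Otimes>\<^sub>M lebesgue_product (- S)) borel (join_coords S)) (box l u)
      = (\<Prod>i\<in>S. ennreal (u $ i - l $ i)) * (\<Prod>i\<in>-S. ennreal (u $ i - l $ i))"
    by (simp add: emeasure_distr preimage PiE N.emeasure_pair_measure_Times)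
  also have "\<dots> = (\<Prod>i\<in>UNIV. ennreal (u $ i - l $ i))"
    by (subst prod.union_disjoint[symmetric]) auto
  also have "\<dots> = ennreal (\<Prod>b\<in>Basis. (u - l) \<bullet> b)"
    using le by (simp add: prod_Basis_cart prod_ennreal)
  finally show "emeasure (distr (lebesgue_product S \<Otimes>\<^sub>M lebesgue_product (- S)) borel (join_coords S)) (box l u)
      = ennreal (\<Prod>b\<in>Basis. (u - l) \<bullet> b)" .
qed simp

lemma stack_component[simp]: "stack x y $ Inl i = x $ i" "stack x y $ Inr i = y $ i"
  by (simp_all add: stack_def)

lemma upper_lower_stack[simp]: "upper (stack x y) = x" "lower (stack x y) = y"
  by (simp_all add: upper_def lower_def vec_eq_iff)

lemma measurable_stack[measurable]:
  "(\<lambda>p. stack (fst p) (snd p)) \<in> borel_measurable ((lborel :: (real ^ 'd) measure) \<Otimes>\<^sub>M (lborel :: (real ^ 'd::finite) measure))"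
proof -
  have [measurable]: "(\<lambda>x::real ^ 'd. x $ a) \<in> borel_measurable borel" for a
    by (intro borel_measurable_continuous_onI continuous_intros)
  have "(\<lambda>p. stack (fst p) (snd p) $ i) \<in> borel_measurable ((lborel :: (real ^ 'd) measure) \<Otimes>\<^sub>M (lborel :: (real ^ 'd) measure))" for i
  proof (cases i)
    case (Inl a)
    have "(\<lambda>p. fst p $ a) \<in> borel_measurable ((lborel :: (real ^ 'd) measure) \<Otimes>\<^sub>M (lborel :: (real ^ 'd) measure))" by measurable
    then show ?thesis by (simp add: Inl)
  next
    case (Inr a)
    have "(\<lambda>p. snd p $ a) \<in> borel_measurable ((lborel :: (real ^ 'd) measure) \<Otimes>\<^sub>M (lborel :: (real ^ 'd) measure))" by measurable
    then show ?thesis by (simp add: Inr)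
  qed
  then show ?thesis
    by (subst borel_measurable_euclidean_space) (auto simp: Basis_vec_def inner_axis)
qed

lemma measurable_upper_lower[measurable]:
  "upper \<in> borel_measurable (borel :: (real ^ ('d::finite + 'd)) measure)"
  "lower \<in> borel_measurable (borel :: (real ^ ('d::finite + 'd)) measure)"
  unfolding upper_def[abs_def] lower_def[abs_def]
  by (auto intro!: borel_measurable_continuous_onI continuous_intros)

lemma distr_stack:
  "distr (lborel \<Otimes>\<^sub>M lborel) borel (\<lambda>p. stack (fst p) (snd p)) = (lborel :: (real ^ ('d::finite + 'd)) measure)"
proof (rule lborel_eqI[symmetric])
  fix l u :: "real ^ ('d + 'd)" assume "\<And>b. b \<in> Basis \<Longrightarrow> l \<bullet> b \<le> u \<bullet> b"
  then have le: "l $ i \<le> u $ i" for i by (metis axis_in_Basis_iff cart_eq_inner_axis real_inner_1_right Basis_real_def insertI1)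
  have preimage: "(\<lambda>p. stack (fst p) (snd p)) -` box l u \<inter> space (lborel \<Otimes>\<^sub>M lborel)
      = box (upper l) (upper u) \<times> box (lower l) (lower u)"
  proof -
    have "stack x y \<in> box l u \<longleftrightarrow> x \<in> box (upper l) (upper u) \<and> y \<in> box (lower l) (lower u)" for x y
      by (auto simp: mem_box_cart upper_def lower_def split_sum_all)
    then show ?thesis by (auto simp: space_pair_measure)
  qed
  have le': "upper l \<bullet> b \<le> upper u \<bullet> b" "lower l \<bullet> b \<le> lower u \<bullet> b" if "b \<in> Basis" for b
    using that le by (auto simp: Basis_vec_def inner_axis upper_def lower_def)
  have "emeasure (distr (lborel \<Otimes>\<^sub>M lborel) borel (\<lambda>p. stack (fst p) (snd p))) (box l u)
      = ennreal (\<Prod>b\<in>Basis. (upper u - upper l) \<bullet> b) * ennreal (\<Prod>b\<in>Basis. (lower u - lower l) \<bullet> b)"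
    using le' by (simp add: emeasure_distr preimage lborel.emeasure_pair_measure_Times)
  also have "\<dots> = ennreal ((\<Prod>i\<in>UNIV. (u - l) $ Inl i) * (\<Prod>i\<in>UNIV. (u - l) $ Inr i))"
    using le by (simp add: prod_Basis_cart upper_def lower_def ennreal_mult prod_nonneg)
  also have "(\<Prod>i\<in>UNIV. (u - l) $ Inl i) * (\<Prod>i\<in>UNIV. (u - l) $ Inr i) = (\<Prod>i\<in>UNIV. (u - l) $ i)"
    by (subst UNIV_Plus_UNIV[symmetric], subst prod.Plus) simp_all
  finally show "emeasure (distr (lborel \<Otimes>\<^sub>M lborel) borel (\<lambda>p. stack (fst p) (snd p))) (box l u)
      = ennreal (\<Prod>b\<in>Basis. (u - l) \<bullet> b)" by (simp add: prod_Basis_cart)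
qed simp

section \<open>Unitary operators and the partial Fourier transform\<close>

lemma inner_swap_matrix: "w \<bullet> (swap_matrix *v w) = 2 * (upper w \<bullet> lower w)"
proof -
  have "(swap_matrix *v w) $ Inl a = w $ Inr a" "(swap_matrix *v w) $ Inr a = w $ Inl a" for a
    by (simp_all add: swap_matrix_def block_matrix_def matrix_vector_mult_def mat_def
        sum.Plus if_distrib[of "\<lambda>c. c * _"] cong: if_cong flip: UNIV_Plus_UNIV)
  then show ?thesis
    unfolding inner_vec_def by (subst UNIV_Plus_UNIV[symmetric], subst sum.Plus)
      (simp_all add: upper_def lower_def mult.commute)
qed

lemma L2_inner_self: "L2_inner f f = of_real (\<integral>x. (cmod (f x))\<^sup>2 \<partial>lborel)"
  unfolding L2_inner_def
  by (simp only: complex_norm_square[symmetric] integral_complex_of_real)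

lemma AE_eq_0_iff_L2_inner_self:
  assumes "L2 f"
  shows "(AE x in lborel. f x = 0) \<longleftrightarrow> L2_inner f f = 0"
proof -
  have "L2_inner f f = 0 \<longleftrightarrow> (\<integral>x. (cmod (f x))\<^sup>2 \<partial>lborel) = 0"
    by (simp add: L2_inner_self del: of_real_power)
  also have "\<dots> \<longleftrightarrow> (AE x in lborel. (cmod (f x))\<^sup>2 = 0)"
    using assms by (intro integral_nonneg_eq_0_iff_AE) (auto simp: L2_def)
  finally show ?thesis by simp
qed

lemma unitary_L2_AE_eq_0_iff:
  assumes "unitary_L2 T" "L2 f"
  shows "(AE x in lborel. T f x = 0) \<longleftrightarrow> (AE x in lborel. f x = 0)"
  using assms by (simp add: AE_eq_0_iff_L2_inner_self unitary_L2_def)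

lemma partial_fourier_integral_join_coords:
  "partial_fourier_integral k g (join_coords (first_coords k) q)
    = product_fourier (first_coords k) (\<lambda>x. g (join_coords (first_coords k) (x, snd q))) (fst q)"
proof -
  have "(\<chi> i. (if i \<in> first_coords k then x i else join_coords (first_coords k) q $ i))
      = join_coords (first_coords k) (x, snd q)" for x
    by (simp add: join_coords_def vec_eq_iff)
  moreover have "(\<Sum>i\<in>first_coords k. join_coords (first_coords k) q $ i * x i) = pairing (first_coords k) (fst q) x" for x
    by (simp add: pairing_def join_coords_def)
  ultimately show ?thesis
    by (simp add: partial_fourier_integral_def product_fourier_def lebesgue_product_def)
qed

lemma inner_join_coords:
  fixes S :: "'d::finite set"
  shows "join_coords S p \<bullet> join_coords S q = pairing S (fst p) (fst q) + pairing (- S) (snd p) (snd q)"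
proof -
  have "join_coords S p \<bullet> join_coords S q
      = (\<Sum>i\<in>S \<union> - S. join_coords S p $ i * join_coords S q $ i)"
    by (simp add: inner_vec_def)
  also have "\<dots> = pairing S (fst p) (fst q) + pairing (- S) (snd p) (snd q)"
    by (subst sum.union_disjoint) (simp_all add: join_coords_def pairing_def)
  finally show ?thesis .
qed

text \<open>
  The weight is at least \<open>1\<close>, so the product of the two \<open>L\<^sup>1\<close> norms is finite; a factor can be
  infinite only if the other one is \<open>0\<close>.
\<close>

lemma both_integrable_if_product_integral_finite:
  fixes u v :: "'a::euclidean_space \<Rightarrow> complex"
  assumes [measurable]: "u \<in> borel_measurable lborel" "v \<in> borel_measurable lborel"
    and fin: "(\<integral>\<^sup>+x. \<integral>\<^sup>+y. ennreal (cmod (u x) * cmod (v y) * exp (2 * pi * \<bar>x \<bullet> y\<bar>)) \<partial>lborel \<partial>lborel) < \<infinity>"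
    and nz: "\<not> (AE x in lborel. u x = 0)" "\<not> (AE x in lborel. v x = 0)"
  shows "integrable lborel u" "integrable lborel v"
proof -
  let ?nn = "\<lambda>w. \<integral>\<^sup>+x. ennreal (cmod (w x)) \<partial>lborel"
  have "?nn u * ?nn v = (\<integral>\<^sup>+x. \<integral>\<^sup>+y. ennreal (cmod (u x) * cmod (v y)) \<partial>lborel \<partial>lborel)"
    by (simp add: ennreal_mult nn_integral_cmult nn_integral_multc)
  also have "\<dots> \<le> (\<integral>\<^sup>+x. \<integral>\<^sup>+y. ennreal (cmod (u x) * cmod (v y) * exp (2 * pi * \<bar>x \<bullet> y\<bar>)) \<partial>lborel \<partial>lborel)"
  proof (intro nn_integral_mono ennreal_leI)
    fix x y :: 'a
    show "cmod (u x) * cmod (v y) \<le> cmod (u x) * cmod (v y) * exp (2 * pi * \<bar>x \<bullet> y\<bar>)"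
      using mult_left_mono[of 1 "exp (2 * pi * \<bar>x \<bullet> y\<bar>)" "cmod (u x) * cmod (v y)"] by simp
  qed
  finally have prod: "?nn u * ?nn v < \<infinity>" using fin by (rule le_less_trans)
  have "?nn u \<noteq> 0" "?nn v \<noteq> 0" using nz by (auto simp: nn_integral_0_iff_AE)
  with prod have "?nn u < \<infinity>" "?nn v < \<infinity>" by (auto simp: ennreal_mult_less_top)
  then show "integrable lborel u" "integrable lborel v" by (auto intro!: integrableI_bounded)
qed

text \<open>
  If \<open>g\<close> is nonzero, then so is its image under the unitary operator \<open>T\<close>, whence both are
  integrable. Integrability is what identifies \<open>T g\<close> with the partial Fourier integral of \<open>g\<close> itself,
  and it reduces the claim to the case of measures on coordinate sets.
\<close>

theorem partial_fourier_beurling: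
  fixes g :: "real ^ 'd::{finite,linorder} \<Rightarrow> complex"
  assumes k: "1 \<le> k" and T: "partial_fourier k T" and g: "L2 g"
    and fin: "(\<integral>\<^sup>+x. \<integral>\<^sup>+y. ennreal (cmod (g x) * cmod (T g y) * exp (2 * pi * \<bar>x \<bullet> y\<bar>)) \<partial>lborel \<partial>lborel) < \<infinity>"
  shows "AE x in lborel. g x = 0"
proof (rule ccontr)
  assume g0: "\<not> (AE x in lborel. g x = 0)"
  have unitary: "unitary_L2 T" using T by (simp add: partial_fourier_def)
  then have Tg0: "\<not> (AE x in lborel. T g x = 0)" using g0 unitary_L2_AE_eq_0_iff[OF _ g] by blast
  have "L2 (T g)" using unitary g by (simp add: unitary_L2_def)
  then have [measurable]: "T g \<in> borel_measurable borel" by (simp add: L2_def)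
  have [measurable]: "g \<in> borel_measurable borel" using g by (simp add: L2_def)
  have int_g: "integrable lborel g" and int_Tg: "integrable lborel (T g)"
    by (rule both_integrable_if_product_integral_finite[OF _ _ fin g0 Tg0]; simp)+
  then have Tg_eq: "AE w in lborel. T g w = partial_fourier_integral k g w"
    using T g by (simp add: partial_fourier_def)
  define S where "S = (first_coords k :: 'd set)"
  let ?J = "join_coords S"
  let ?M = "lebesgue_product S \<Otimes>\<^sub>M lebesgue_product (- S)"
  interpret N: sigma_finite_measure "lebesgue_product S" by (rule sigma_finite_lebesgue_product) simp
  interpret N': sigma_finite_measure "lebesgue_product (- S)" by (rule sigma_finite_lebesgue_product) simp
  interpret P: pair_sigma_finite "lebesgue_product S" "lebesgue_product (- S)" by unfold_locales
  \<comment> \<open>at least one coordinate is transformed, since \<open>k \<ge> 1\<close>\<close>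
  have "Min UNIV \<in> S"
  proof -
    have "{j. j < Min (UNIV :: 'd set)} = {}" by (auto simp: not_less)
    then show ?thesis using k unfolding S_def first_coords_def mem_Collect_eq by (simp only: card.empty)
  qed
  then have "S \<noteq> {}" by blast
  define h where "h = (\<lambda>q. product_fourier S (\<lambda>x. g (?J (x, snd q))) (fst q))"
  have [measurable]: "h \<in> borel_measurable ?M"
    unfolding h_def product_fourier_def by measurable
  have "AE w in distr ?M borel ?J. T g w = partial_fourier_integral k g w"
    using Tg_eq unfolding distr_join_coords .
  then have "AE q in ?M. T g (?J q) = partial_fourier_integral k g (?J q)"
    by (rule AE_distrD[rotated]) measurable
  then have h_eq: "AE q in ?M. h q = T g (?J q)"
    by (simp add: h_def S_def partial_fourier_integral_join_coords eq_commute)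
  have int_gJ: "integrable ?M (\<lambda>p. g (?J p))"
    using int_g distr_join_coords[of S] by (metis integrable_distr measurable_join_coords)
  have "integrable ?M (\<lambda>q. T g (?J q))"
    using int_Tg distr_join_coords[of S] by (metis integrable_distr measurable_join_coords)
  then have int_h: "integrable ?M h" by (rule integrable_cong_AE_imp) (use h_eq in auto)
  have "(\<integral>\<^sup>+ p. \<integral>\<^sup>+ q. ennreal (cmod (g (?J p)) * cmod (h q) *
        exp (2 * pi * \<bar>pairing S (fst p) (fst q) + pairing (- S) (snd p) (snd q)\<bar>)) \<partial>?M \<partial>?M)
      = (\<integral>\<^sup>+ p. \<integral>\<^sup>+ q. ennreal (cmod (g (?J p)) * cmod (T g (?J q)) * exp (2 * pi * \<bar>?J p \<bullet> ?J q\<bar>)) \<partial>?M \<partial>?M)"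
    by (rule nn_integral_cong, rule nn_integral_cong_AE, rule AE_mp[OF h_eq]) (simp add: inner_join_coords)
  also have "\<dots> = (\<integral>\<^sup>+ x. \<integral>\<^sup>+ y. ennreal (cmod (g x) * cmod (T g y) * exp (2 * pi * \<bar>x \<bullet> y\<bar>))
      \<partial>distr ?M borel ?J \<partial>distr ?M borel ?J)"
    by (simp add: nn_integral_distr)
  finally have fin_h: "(\<integral>\<^sup>+ p. \<integral>\<^sup>+ q. ennreal (cmod (g (?J p)) * cmod (h q) *
        exp (2 * pi * \<bar>pairing S (fst p) (fst q) + pairing (- S) (snd p) (snd q)\<bar>)) \<partial>?M \<partial>?M) < \<infinity>"
    using fin by (simp add: distr_join_coords)
  have "AE q in ?M. h q = 0"
    using int_h fin_h unfolding h_def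
    by (intro partial_beurling_lebesgue_product[OF _ \<open>S \<noteq> {}\<close> _ int_gJ]) simp_all
  with h_eq have "AE q in ?M. T g (?J q) = 0" by eventually_elim simp
  then have "AE w in distr ?M borel ?J. T g w = 0" by (subst AE_distr_iff) simp_all
  with Tg0 show False unfolding distr_join_coords by blast
qed

section \<open>Vanishing of functions with a rapidly decaying factorized tensor product\<close>

theorem theorem5p6:
  fixes V :: "complex ^ ('d::{finite,linorder}) ^ ('d::{finite,linorder})"
    and \<B> \<Omega> :: "real ^ (('d::{finite,linorder}) + ('d::{finite,linorder})) ^ (('d::{finite,linorder}) + ('d::{finite,linorder}))"
    and k :: nat
    and RV_op B_op F_k :: "(real ^ ('d::{finite,linorder}) \<Rightarrow> complex) \<Rightarrow> real ^ ('d::{finite,linorder}) \<Rightarrow> complex"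
    and f :: "real ^ ('d::{finite,linorder}) \<Rightarrow> complex"
  assumes "unitary_matrix V"
    and "\<not> real_valued_matrix V"
    and "metaplectic (symplectic_rotation V) RV_op"
    and "1 \<le> k" and "k \<le> CARD('d)"
    and "partial_fourier k F_k"
    and "symplectic \<B>"
    and "metaplectic \<B> B_op"
    and "invertible \<Omega>"
    and factorization: "\<And>u. L2 u \<Longrightarrow>
      AE z in lborel.
        tensor (\<lambda>x. cmod (u x)) (\<lambda>x. cmod (RV_op u x)) z =
        dilation \<Omega> (tensor (\<lambda>x. cmod (B_op u x)) (\<lambda>x. cmod (F_k (B_op u) x))) z"
    and "L2 f"
    and "(\<integral>\<^sup>+ z. ennreal (cmod (tensor f (RV_op f) z) *
            exp (pi * \<bar>(matrix_inv \<Omega> *v z) \<bullet> (swap_matrix *v (matrix_inv \<Omega> *v z))\<bar>)) \<partial>lborel) < \<infinity>"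
  shows "AE x in lborel. f x = 0"
proof -
  define g where "g = B_op f"
  let ?h = "F_k g" and ?L = "\<lambda>z. matrix_inv \<Omega> *v z"
  have B: "unitary_L2 B_op" using assms by (simp add: metaplectic_def)
  have F: "unitary_L2 F_k" using assms by (simp add: partial_fourier_def)
  have g: "L2 g" unfolding g_def using B \<open>L2 f\<close> by (simp add: unitary_L2_def)
  then have h: "L2 ?h" using F by (simp add: unitary_L2_def)
  have [measurable]: "g \<in> borel_measurable borel" "?h \<in> borel_measurable borel"
    using g h by (simp_all add: L2_def)
  \<comment> \<open>by the factorization, the given integrand is a multiple of \<open>P\<close> composed with the inverse of \<open>\<Omega>\<close>\<close>
  define P where "P = (\<lambda>w. cmod (g (upper w)) * cmod (?h (lower w)) * exp (2 * pi * \<bar>upper w \<bullet> lower w\<bar>))"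
  have [measurable]: "P \<in> borel_measurable borel" unfolding P_def by measurable
  define c where "c = \<bar>det \<Omega>\<bar> powr (- 1 / 2)"
  have "c > 0" using \<open>invertible \<Omega>\<close> by (simp add: c_def invertible_det_nz)
  have "AE z in lborel. cmod (tensor f (RV_op f) z) *
      exp (pi * \<bar>?L z \<bullet> (swap_matrix *v ?L z)\<bar>) = c * P (?L z)"
    using factorization[OF \<open>L2 f\<close>]
  proof eventually_elim
    case (elim z)
    have "cmod (tensor f (RV_op f) z) = c * (cmod (g (upper (?L z))) * cmod (?h (lower (?L z))))"
      using elim by (simp add: tensor_def dilation_def norm_mult c_def g_def)
    then show ?case by (simp add: P_def inner_swap_matrix abs_mult mult_ac)
  qed
  then have "(\<integral>\<^sup>+z. ennreal (c * P (?L z)) \<partial>lborel) < \<infinity>"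
    using assms(12) by (subst nn_integral_cong_AE[where v = "\<lambda>z. ennreal (cmod (tensor f (RV_op f) z) *
            exp (pi * \<bar>?L z \<bullet> (swap_matrix *v ?L z)\<bar>))"]) (auto elim: eventually_mono)
  moreover have "(\<lambda>z. P (?L z)) \<in> borel_measurable borel"
    by (rule measurable_compose[of ?L borel borel])
       (auto intro!: borel_measurable_continuous_onI linear_continuous_on_compose[OF continuous_on_id])
  ultimately have "ennreal c * (\<integral>\<^sup>+z. ennreal (P (?L z)) \<partial>lborel) < \<infinity>"
    using \<open>c > 0\<close> by (simp add: ennreal_mult' nn_integral_cmult)
  then have "(\<integral>\<^sup>+z. ennreal (P (?L z)) \<partial>lborel) < \<infinity>"
    using \<open>c > 0\<close> by (auto simp: ennreal_mult_less_top)
  then have "(\<integral>\<^sup>+w. ennreal (P w) \<partial>lborel) < \<infinity>"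
  proof (rule nn_integral_linear_image_finite[where K = "\<lambda>y. \<Omega> *v y", rotated 3])
    have "matrix_inv \<Omega> ** \<Omega> = mat 1"
      using \<open>invertible \<Omega>\<close> unfolding invertible_def matrix_inv_def by (rule someI2_ex) simp
    then show "?L (\<Omega> *v y) = y" for y by (simp add: matrix_vector_mul_assoc)
  qed simp_all
  also have "(\<integral>\<^sup>+w. ennreal (P w) \<partial>lborel)
      = (\<integral>\<^sup>+p. ennreal (P (stack (fst p) (snd p))) \<partial>(lborel \<Otimes>\<^sub>M lborel))"
    by (subst distr_stack[symmetric]) (simp add: nn_integral_distr)
  also have "\<dots> = (\<integral>\<^sup>+x. \<integral>\<^sup>+y. ennreal (cmod (g x) * cmod (?h y) * exp (2 * pi * \<bar>x \<bullet> y\<bar>)) \<partial>lborel \<partial>lborel)"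
    by (subst lborel.nn_integral_fst[symmetric]) (simp_all add: P_def)
  finally have "AE x in lborel. g x = 0"
    using \<open>1 \<le> k\<close> \<open>partial_fourier k F_k\<close> g by (intro partial_fourier_beurling)
  then show ?thesis
    using unitary_L2_AE_eq_0_iff[OF B \<open>L2 f\<close>] by (simp add: g_def)
qed

end
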